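(* Let $0\le\alpha<1$ and $0\le x_1<x_2\le1$, let $\mathcal{M}=\mathcal{M}_{\alpha,x_1,x_2}$ be the transformation of $[0,1)$ defined in the context, with coherent map $\widetilde{\mathcal M}$, maximal invariant set $\mathcal{S}$ and symmetric maximal invariant set $\mathcal{E}$. If $\mathcal{E}\ne\emptyset$, then $$\mathcal{E}=\mathcal{S}\cap(1-\pi(\mathcal{S})),$$ and for each $t\in\mathcal{E}$, $$\mathcal{M}\big(1-\widetilde{\mathcal M}(1-t)\big)=1-\widetilde{\mathcal M}\big(1-\mathcal{M}(t)\big)=t.$$
   Context: $\langle x\rangle=x-\lfloor x\rfloor$ is the fractional part of $x$ and $\langle x\rangle^\ast=1-\langle1-x\rangle\in(0,1]$. For $0\le\alpha<1$ and $0\le x_1<x_2\le 1$ put $U=[0,x_1)$, $\mathbf H=[x_1,x_2)$, $V=[x_2,1)$ and $\widetilde U=(0,x_1]$, $\widetilde{\mathbf H}=(x_1,x_2]$, $\widetilde V=(x_2,1]$. The map $\mathcal{M}=\mathcal{M}_{\alpha,x_1,x_2}:[0,1)\to[0,1)$ is $\mathcal{M}(t)=\langle t+\alpha+x_2-x_1\rangle$ for $t\in U$, $\mathcal{M}(t)=t$ for $t\in\mathbf H$, $\mathcal{M}(t)=\langle t+\alpha\rangle$ for $t\in V$. Its coherent map $\widetilde{\mathcal M}:(0,1]\to(0,1]$ is $\widetilde{\mathcal M}(t)=\langle t+\alpha+x_2-x_1\rangle^\ast$ for $t\in\widetilde U$, $\widetilde{\mathcal M}(t)=t$ for $t\in\widetilde{\mathbf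 H}$, $\widetilde{\mathcal M}(t)=\langle t+\alpha\rangle^\ast$ for $t\in\widetilde V$. The maximal invariant set $\mathcal{S}$ of $\mathcal{M}$ is the largest set $\mathcal{S}\subset[0,1)\setminus\mathbf H$ with $\mathcal{M}(\mathcal{S})=\mathcal{S}$; it is a finite union of left-closed right-open intervals. The symmetric maximal invariant set $\mathcal{E}$ is the largest set $\mathcal{E}\subset[0,1)\setminus\big(\mathbf H\cup(1-\widetilde{\mathbf H})\big)$ with $\mathcal{M}(\mathcal{E})=\mathcal{E}$ and $\widetilde{\mathcal M}(1-\mathcal{E})=1-\mathcal{E}$, where $1-E=\{1-t:t\in E\}$. For $J=[c,d)\subset[0,1)$, $\pi(J)=(c,d]\subset(0,1]$; for a finite union $E=\bigcup_k J_k$ of such intervals, $\pi(E)=\bigcup_k\pi(J_k)$. *)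

theory Defs
  imports "HOL-Analysis.Analysis"
begin

definition frac_star :: "real \<Rightarrow> real" where
  "frac_star x = 1 - frac (1 - x)"

definition reflect :: "real set \<Rightarrow> real set" where
  "reflect E = (\<lambda>t. 1 - t) ` E"

text \<open>The two maps are total functions on the reals, but only their values on \<open>[0,1)\<close>
  and on \<open>(0,1]\<close>, respectively, are meaningful. The parameters are \<open>\<alpha>\<close>, \<open>x1\<close>, \<open>x2\<close>,
  with \<open>U = [0,x1)\<close>, \<open>H = [x1,x2)\<close>, \<open>V = [x2,1)\<close>, and their mirror versions
  \<open>(0,x1]\<close>, \<open>(x1,x2]\<close>, \<open>(x2,1]\<close> for the coherent map.\<close>

definition transf :: "real \<Rightarrow> real \<Rightarrow> real \<Rightarrow> real \<Rightarrow> real" where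
  "transf \<alpha> x1 x2 t =
     (if t \<in> {0..<x1} then frac (t + \<alpha> + x2 - x1)
      else if t \<in> {x2..<1} then frac (t + \<alpha>)
      else t)"

definition coherent_transf :: "real \<Rightarrow> real \<Rightarrow> real \<Rightarrow> real \<Rightarrow> real" where
  "coherent_transf \<alpha> x1 x2 t =
     (if t \<in> {0<..x1} then frac_star (t + \<alpha> + x2 - x1)
      else if t \<in> {x2<..1} then frac_star (t + \<alpha>)
      else t)"

definition invariant_off_hole :: "real \<Rightarrow> real \<Rightarrow> real \<Rightarrow> real set \<Rightarrow> bool" where
  "invariant_off_hole \<alpha> x1 x2 S \<longleftrightarrow>
     S \<subseteq> {0..<1} - {x1..<x2} \<and> transf \<alpha> x1 x2 ` S = S"

definition max_invariant_set :: "real \<Rightarrow> real \<Rightarrow> real \<Rightarrow> real set" where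
  "max_invariant_set \<alpha> x1 x2 = (GREATEST S. invariant_off_hole \<alpha> x1 x2 S)"

definition sym_invariant_off_hole :: "real \<Rightarrow> real \<Rightarrow> real \<Rightarrow> real set \<Rightarrow> bool" where
  "sym_invariant_off_hole \<alpha> x1 x2 E \<longleftrightarrow>
     E \<subseteq> {0..<1} - ({x1..<x2} \<union> reflect {x1<..x2}) \<and>
     transf \<alpha> x1 x2 ` E = E \<and>
     coherent_transf \<alpha> x1 x2 ` reflect E = reflect E"

definition sym_max_invariant_set :: "real \<Rightarrow> real \<Rightarrow> real \<Rightarrow> real set" where
  "sym_max_invariant_set \<alpha> x1 x2 = (GREATEST E. sym_invariant_off_hole \<alpha> x1 x2 E)"

text \<open>Both greatest sets exist, since the defining conditions are closed under unions.\<close>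

lemma max_invariant_set_greatest:
  shows "invariant_off_hole \<alpha> x1 x2 (max_invariant_set \<alpha> x1 x2)"
    and "invariant_off_hole \<alpha> x1 x2 S \<Longrightarrow> S \<subseteq> max_invariant_set \<alpha> x1 x2"
proof -
  let ?W = "\<Union>{S. invariant_off_hole \<alpha> x1 x2 S}"
  have W: "invariant_off_hole \<alpha> x1 x2 ?W"
    unfolding invariant_off_hole_def
  proof
    let ?P = "\<lambda>S. S \<subseteq> {0..<1} - {x1..<x2} \<and> transf \<alpha> x1 x2 ` S = S"
    show "\<Union>{S. ?P S} \<subseteq> {0..<1} - {x1..<x2}" by (rule Union_least) simp
    have "(\<lambda>S. transf \<alpha> x1 x2 ` S) ` {S. ?P S} = id ` {S. ?P S}"
      by (rule image_cong) auto
    then show "transf \<alpha> x1 x2 ` \<Union>{S. ?P S} = \<Union>{S. ?P S}"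
      unfolding image_Union by simp
  qed
  have "max_invariant_set \<alpha> x1 x2 = ?W"
    unfolding max_invariant_set_def
  proof (rule Greatest_equality)
    show "invariant_off_hole \<alpha> x1 x2 ?W" by (rule W)
    show "S \<subseteq> ?W" if "invariant_off_hole \<alpha> x1 x2 S" for S
      using that by (intro Union_upper) simp
  qed
  note eq = this
  show "invariant_off_hole \<alpha> x1 x2 (max_invariant_set \<alpha> x1 x2)"
    unfolding eq by (rule W)
  show "S \<subseteq> max_invariant_set \<alpha> x1 x2" if "invariant_off_hole \<alpha> x1 x2 S"
    unfolding eq using that by (intro Union_upper) simp
qed

lemma sym_max_invariant_set_greatest:
  shows "sym_invariant_off_hole \<alpha> x1 x2 (sym_max_invariant_set \<alpha> x1 x2)"
    and "sym_invariant_off_hole \<alpha> x1 x2 E \<Longrightarrow> E \<subseteq> sym_max_invariant_set \<alpha> x1 x2"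
proof -
  let ?W = "\<Union>{E. sym_invariant_off_hole \<alpha> x1 x2 E}"
  have W: "sym_invariant_off_hole \<alpha> x1 x2 ?W"
    unfolding sym_invariant_off_hole_def
  proof (intro conjI)
    let ?F = "{E. E \<subseteq> {0..<1} - ({x1..<x2} \<union> reflect {x1<..x2}) \<and>
      transf \<alpha> x1 x2 ` E = E \<and> coherent_transf \<alpha> x1 x2 ` reflect E = reflect E}"
    show "\<Union>?F \<subseteq> {0..<1} - ({x1..<x2} \<union> reflect {x1<..x2})"
      by (rule Union_least) simp
    have "(\<lambda>E. transf \<alpha> x1 x2 ` E) ` ?F = id ` ?F"
      by (rule image_cong) auto
    then show "transf \<alpha> x1 x2 ` \<Union>?F = \<Union>?F"
      unfolding image_Union by simp
    have R: "reflect (\<Union>?F) = \<Union>(reflect ` ?F)"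
      unfolding reflect_def by (rule image_Union)
    have "(\<lambda>E. coherent_transf \<alpha> x1 x2 ` reflect E) ` ?F = reflect ` ?F"
      by (rule image_cong) auto
    then show "coherent_transf \<alpha> x1 x2 ` reflect (\<Union>?F) = reflect (\<Union>?F)"
      unfolding R by (simp only: image_Union image_image)
  qed
  have "sym_max_invariant_set \<alpha> x1 x2 = ?W"
    unfolding sym_max_invariant_set_def
  proof (rule Greatest_equality)
    show "sym_invariant_off_hole \<alpha> x1 x2 ?W" by (rule W)
    show "E \<subseteq> ?W" if "sym_invariant_off_hole \<alpha> x1 x2 E" for E
      using that by (intro Union_upper) simp
  qed
  note eq = this
  show "sym_invariant_off_hole \<alpha> x1 x2 (sym_max_invariant_set \<alpha> x1 x2)"
    unfolding eq by (rule W)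
  show "E \<subseteq> sym_max_invariant_set \<alpha> x1 x2" if "sym_invariant_off_hole \<alpha> x1 x2 E"
    unfolding eq using that by (intro Union_upper) simp
qed

definition interval_decomp :: "(real \<times> real) set \<Rightarrow> real set \<Rightarrow> bool" where
  "interval_decomp K E \<longleftrightarrow>
     finite K \<and> (\<forall>(c, d)\<in>K. 0 \<le> c \<and> c < d \<and> d \<le> 1) \<and> E = (\<Union>(c, d)\<in>K. {c..<d})"

text \<open>The map \<open>\<pi>\<close>. It is meaningful only for finite unions of intervals \<open>[c,d)\<close> contained in
  \<open>[0,1)\<close>; for these, the value does not depend on the decomposition
  (lemma \<open>flip_ends_eq\<close>).\<close>

definition flip_ends :: "real set \<Rightarrow> real set" where
  "flip_ends E = (THE P. \<exists>K. interval_decomp K E \<and> P = (\<Union>(c, d)\<in>K. {c<..d}))"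

lemma interval_decomp_flip:
  assumes "interval_decomp K E"
  shows "(\<Union>(c, d)\<in>K. {c<..d}) = {t. \<exists>s<t. {s..<t} \<subseteq> E}"
proof (intro equalityI subsetI)
  fix t assume "t \<in> (\<Union>(c, d)\<in>K. {c<..d})"
  then obtain c d where "(c, d) \<in> K" "c < t" "t \<le> d" by auto
  moreover from this have "{c..<t} \<subseteq> E"
    using assms unfolding interval_decomp_def by (auto intro!: bexI[of _ "(c, d)"])
  ultimately show "t \<in> {t. \<exists>s<t. {s..<t} \<subseteq> E}" by auto
next
  fix t assume "t \<in> {t. \<exists>s<t. {s..<t} \<subseteq> E}"
  then obtain s where s: "s < t" "{s..<t} \<subseteq> E" by auto
  define D where "D = insert s {d \<in> snd ` K. d < t}"
  have fin: "finite D" using assms unfolding D_def interval_decomp_def by auto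
  have ne: "D \<noteq> {}" unfolding D_def by simp
  have "Max D < t" using s fin ne unfolding D_def by (subst Max_less_iff) auto
  then obtain u where u: "Max D < u" "u < t" using dense by blast
  have uD: "d < u" if "d \<in> D" for d using that u(1) fin Max_ge[of D d] by linarith
  have "s < u" by (rule uD) (simp add: D_def)
  then have "u \<in> E" using s u by auto
  then obtain c d where cd: "(c, d) \<in> K" "c \<le> u" "u < d"
    using assms unfolding interval_decomp_def by auto
  have "t \<le> d"
  proof (rule ccontr)
    assume "\<not> t \<le> d"
    then have "d \<in> D" using cd unfolding D_def by force
    then show False using uD cd by fastforce
  qed
  then have "t \<in> {c<..d}" using cd u by simp
  then show "t \<in> (\<Union>(c, d)\<in>K. {c<..d})" using cd(1) by blast
qed

lemma flip_ends_eq: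
  assumes "interval_decomp K E"
  shows "flip_ends E = (\<Union>(c, d)\<in>K. {c<..d})"
  unfolding flip_ends_def
proof (rule the_equality)
  show "\<exists>K'. interval_decomp K' E \<and> (\<Union>(c, d)\<in>K. {c<..d}) = (\<Union>(c, d)\<in>K'. {c<..d})"
    by (rule exI[where x = K]) (simp only: assms simp_thms)
next
  fix P assume "\<exists>K'. interval_decomp K' E \<and> P = (\<Union>(c, d)\<in>K'. {c<..d})"
  then obtain K' where K': "interval_decomp K' E" "P = (\<Union>(c, d)\<in>K'. {c<..d})"
    by (elim exE conjE)
  show "P = (\<Union>(c, d)\<in>K. {c<..d})"
    unfolding K'(2) interval_decomp_flip[OF K'(1)] interval_decomp_flip[OF assms] by (rule refl)
qed

end

theory Submission
  imports Defs
begin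

text \<open>Let \<open>h = x2 - x1\<close>, let \<open>M\<close> be the map and \<open>N t = 1 - M' (1 - t)\<close> its reflected coherent map
  \<open>M'\<close>. On the symmetric set \<open>E\<close> the composition \<open>M \<circ> N\<close> translates by \<open>0\<close> or \<open>\<plusminus>h\<close>, and a nonzero
  translation would repeat forever in the same direction without leaving the unit interval; hence
  \<open>M\<close> and \<open>N\<close> are inverse on \<open>E\<close>. It follows that \<open>M\<close> is on \<open>E\<close> a rotation of a circle of
  length \<open>1 + h\<close> if \<open>E\<close> meets both sides of the hole, and of length \<open>1\<close> otherwise. As \<open>E\<close> misses an
  interval of length \<open>h\<close> on this circle, the rotation is rational, and the circle consists of \<open>p\<close>
  cells of length \<open>L\<close> that it permutes cyclically. At each passage through the cell of the hole, a
  point on the wrong side of a threshold within its cell is moved by \<open>h\<close> towards the hole, and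
  finally falls into it; so the maximal invariant set \<open>S\<close> is the union of the same subinterval of
  all cells. This makes \<open>S \<inter> (1 - \<pi>(S))\<close> explicit, and it is invariant under \<open>M\<close> and \<open>N\<close>.\<close>

section \<open>Unions of translated intervals\<close>

text \<open>On a circle of length \<open>p * L\<close>, cut into \<open>p\<close> cells of length
  \<open>L\<close>, this is the same subinterval taken in each cell. Such a union is compatible with
  every rotation by a multiple of \<open>L\<close>.\<close>

definition cells :: "int \<Rightarrow> real \<Rightarrow> real \<Rightarrow> real \<Rightarrow> real set" where
  "cells p L a b = (\<Union>i\<in>{0..<p}. {of_int i * L + a..<of_int i * L + b})"

lemma cells_iff:
  "t \<in> cells p L a b \<longleftrightarrow> (\<exists>i r. 0 \<le> i \<and> i < p \<and> a \<le> r \<and> r < b \<and> t = of_int i * L + r)"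
proof
  assume "t \<in> cells p L a b"
  then obtain i where "0 \<le> i" "i < p" "of_int i * L + a \<le> t" "t < of_int i * L + b"
    unfolding cells_def by auto
  then show "\<exists>i r. 0 \<le> i \<and> i < p \<and> a \<le> r \<and> r < b \<and> t = of_int i * L + r"
    by (intro exI[of _ i] exI[of _ "t - of_int i * L"]) auto
next
  assume "\<exists>i r. 0 \<le> i \<and> i < p \<and> a \<le> r \<and> r < b \<and> t = of_int i * L + r"
  then obtain i r where "0 \<le> i" "i < p" "a \<le> r" "r < b" "t = of_int i * L + r" by blast
  then show "t \<in> cells p L a b" unfolding cells_def by (intro UN_I[of i]) auto
qed

lemma cell_index_le:
  fixes L r :: real and i j :: int
  assumes "0 < L" "of_int i * L \<le> of_int j * L + r" "r < L"
  shows "i \<le> j"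
proof (rule ccontr)
  assume "\<not> i \<le> j"
  then have "of_int (j + 1) * L \<le> of_int i * L"
    using assms(1) by (intro mult_right_mono) (simp_all del: of_int_add)
  then show False using assms by (simp add: algebra_simps)
qed

lemma cell_index_range:
  fixes L r :: real and z p :: int
  assumes "0 < L" "0 \<le> r" "r < L" "0 \<le> of_int z * L + r" "of_int z * L + r < of_int p * L"
  shows "0 \<le> z" "z < p"
proof -
  show "0 \<le> z" using cell_index_le[of L 0 z r] assms by simp
  have "\<not> p \<le> z"
  proof
    assume "p \<le> z"
    then have "of_int p * L \<le> of_int z * L" using assms(1) by (intro mult_right_mono) simp_all
    then show False using assms by linarith
  qed
  then show "z < p" by simp
qed

lemma floor_cell:
  fixes L r :: real
  assumes "0 < L" "0 \<le> r" "r < L"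
  shows "\<lfloor>(of_int z * L + r) / L\<rfloor> = z"
proof -
  have "(of_int z * L + r) / L = of_int z + r / L" using assms by (simp add: field_simps)
  then show ?thesis using assms by (intro floor_unique) (simp_all)
qed

lemma cell_exists:
  fixes L t :: real
  assumes "0 < L"
  obtains z :: int and r where "t = of_int z * L + r" "0 \<le> r" "r < L"
proof
  let ?z = "\<lfloor>t / L\<rfloor>"
  show "t = of_int ?z * L + (t - of_int ?z * L)" by simp
  have "of_int ?z * L \<le> t" "t < (of_int ?z + 1) * L"
    using assms floor_correct[of "t / L"]
    by (simp_all only: pos_le_divide_eq[symmetric] pos_divide_less_eq[symmetric])
      (simp_all only: of_int_add of_int_1)
  then show "0 \<le> t - of_int ?z * L" "t - of_int ?z * L < L" by (simp_all add: algebra_simps)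
qed

text \<open>The map keeps the offset inside the cell and adds \<open>k\<close> to the index. The
  winding number \<open>n\<close> may vary with \<open>t\<close>, but the range of \<open>f\<close>
  fixes it, so the index is taken modulo \<open>p\<close>, and adding \<open>k\<close> permutes the
  residues.\<close>

lemma cells_rotation:
  fixes f :: "real \<Rightarrow> real"
  assumes L: "0 < L" and p: "0 < p" and ab: "0 \<le> a" "b \<le> L"
    and f: "\<And>t. t \<in> cells p L a b \<Longrightarrow>
      0 \<le> f t \<and> f t < of_int p * L \<and> (\<exists>n::int. f t = t + of_int k * L + of_int n * (of_int p * L))"
  shows "f ` cells p L a b = cells p L a b"
proof -
  have *: "f (of_int i * L + r) = of_int ((i + k) mod p) * L + r"
    if "0 \<le> i" "i < p" "a \<le> r" "r < b" for i r
  proof -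
    let ?t = "of_int i * L + r"
    have "?t \<in> cells p L a b" using that unfolding cells_iff by blast
    from f[OF this] obtain n where n: "0 \<le> f ?t" "f ?t < of_int p * L"
      "f ?t = ?t + of_int k * L + of_int n * (of_int p * L)" by blast
    have e: "f ?t = of_int (i + k + n * p) * L + r"
      unfolding n(3) by (simp add: algebra_simps)
    have "0 \<le> i + k + n * p" "i + k + n * p < p"
      using cell_index_range[of L r "i + k + n * p" p] n L that ab e by auto
    then have "(i + k) mod p = i + k + n * p"
      by (metis mod_mult_self1 mod_pos_pos_trivial)
    then show ?thesis using e by simp
  qed
  show ?thesis
  proof (intro equalityI subsetI)
    fix y assume "y \<in> f ` cells p L a b"
    then obtain t where t: "t \<in> cells p L a b" "y = f t" by blast
    then obtain i r where ir: "0 \<le> i" "i < p" "a \<le> r" "r < b" "t = of_int i * L + r"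
      unfolding cells_iff by blast
    then have "y = of_int ((i + k) mod p) * L + r" using * t(2) by blast
    moreover have "0 \<le> (i + k) mod p" "(i + k) mod p < p" using p by simp_all
    ultimately show "y \<in> cells p L a b" using ir(3,4) unfolding cells_iff by blast
  next
    fix y assume "y \<in> cells p L a b"
    then obtain i r where ir: "0 \<le> i" "i < p" "a \<le> r" "r < b" "y = of_int i * L + r"
      unfolding cells_iff by blast
    let ?i = "(i - k) mod p"
    have i: "0 \<le> ?i" "?i < p" using p by auto
    have "(?i + k) mod p = i" using ir by (simp add: mod_simps)
    then have "f (of_int ?i * L + r) = y" using *[OF i ir(3,4)] ir(5) by simp
    moreover have "of_int ?i * L + r \<in> cells p L a b" using i ir unfolding cells_iff by blast
    ultimately show "y \<in> f ` cells p L a b" by blast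
  qed
qed

text \<open>Rotating the index by \<open>k\<close> leads to \<open>j\<close> after finitely many steps, where the height
  drops by \<open>h\<close>; this cannot go on forever.\<close>

lemma no_trapped_points:
  fixes v :: "'a \<Rightarrow> real" and idx :: "'a \<Rightarrow> int"
  assumes p: "0 < p" and h: "0 < h" and bez: "k * m + p * n = 1"
    and X: "\<And>t. t \<in> X \<Longrightarrow> f t \<in> X" "\<And>t. t \<in> X \<Longrightarrow> 0 \<le> v t"
    and drop: "\<And>t. t \<in> X \<Longrightarrow> idx t mod p = j mod p \<Longrightarrow> v (f t) \<le> v t - h"
    and rot: "\<And>t. t \<in> X \<Longrightarrow> idx t mod p \<noteq> j mod p \<Longrightarrow>
      v (f t) \<le> v t \<and> idx (f t) mod p = (idx t + k) mod p"
  shows "X = {}"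
proof -
  \<comment> \<open>The outer induction counts drops: a height below \<open>N * h\<close> cannot
    survive \<open>N\<close> of them.\<close>
  have low: "\<not> v t < real N * h" if "t \<in> X" for t N
    using that
  proof (induction N arbitrary: t)
    case 0
    then show ?case using X(2)[of t] by simp
  next
    case (Suc N)
    \<comment> \<open>The inner induction counts the rotations \<open>s\<close> after which the
      index reaches \<open>j\<close>. Arriving earlier only brings the drop forward.\<close>
    have wait: "\<not> v t < real (Suc N) * h" if "t \<in> X" "(idx t + int s * k) mod p = j mod p" for s t
      using that
    proof (induction s arbitrary: t)
      case 0
      then show ?case using drop[of t] Suc.IH[OF X(1), of t] by (auto simp: algebra_simps)
    next
      case (Suc s)
      show ?case
      proof (cases "idx t mod p = j mod p")
        case True
        then show ?thesis
          using Suc.prems drop[of t] \<open>\<And>t. t \<in> X \<Longrightarrow> \<not> v t < real N * h\<close>[OF X(1), of t]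
          by (auto simp: algebra_simps)
      next
        case False
        have "(idx (f t) + int s * k) mod p = (idx t + k + int s * k) mod p"
          using rot[OF Suc.prems(1) False] by (metis mod_add_left_eq)
        also have "\<dots> = j mod p" using Suc.prems(2) by (simp add: algebra_simps)
        finally have "\<not> v (f t) < real (Suc N) * h" using Suc.IH X(1) Suc.prems(1) by blast
        then show ?thesis using rot[OF Suc.prems(1) False] by linarith
      qed
    qed
    \<comment> \<open>By \<open>bez\<close>, \<open>m\<close> is inverse to \<open>k\<close> modulo
      \<open>p\<close>, so \<open>?d\<close> rotations by \<open>k\<close> lead from the index of
      \<open>t\<close> to \<open>j\<close>.\<close>
    let ?d = "(j - idx t) * m mod p"
    have "0 \<le> ?d" using p by simp
    then have "(idx t + int (nat ?d) * k) mod p = (idx t + (j - idx t) * m mod p * k) mod p"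
      by simp
    also have "\<dots> = (idx t + (j - idx t) * m * k) mod p" 
      by (metis mod_add_right_eq mod_mult_left_eq)
    also have "(j - idx t) * m * k = (j - idx t) * (k * m)" by (simp add: mult_ac)
    finally have "(idx t + int (nat ?d) * k) mod p = (idx t + (j - idx t) * (k * m)) mod p" .
    also have "idx t + (j - idx t) * (k * m) = j + p * (- n * (j - idx t))"
    proof -
      have km: "k * m = 1 - p * n" using bez by simp
      show ?thesis unfolding km by (simp add: algebra_simps)
    qed
    also have "\<dots> mod p = j mod p" by (rule mod_mult_self2)
    finally show ?case using wait Suc.prems by blast
  qed
  show ?thesis
  proof (rule ccontr)
    assume "X \<noteq> {}"
    then obtain t where "t \<in> X" by blast
    moreover obtain N where "v t < real N * h" using reals_Archimedean3[OF h] by blast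
    ultimately show False using low by blast
  qed
qed

text \<open>The group generated by \<open>a\<close> and \<open>\<Lambda>\<close> has no element in \<open>(0, h]\<close>, since its multiples would
  move a point of \<open>E\<close> into the avoided interval; so it is discrete, with generator \<open>L > h\<close>.\<close>

lemma rotation_lattice:
  fixes f :: "real \<Rightarrow> real" and a \<Lambda> h y :: real
  assumes ne: "E \<noteq> {}" and fE: "f ` E = E" and \<Lambda>: "0 < \<Lambda>" and h: "0 < h"
    and rot: "\<And>e. e \<in> E \<Longrightarrow> \<exists>j::int. f e = e + a + of_int j * \<Lambda>"
    and avoid: "\<And>e (j::int). e \<in> E \<Longrightarrow> e + of_int j * \<Lambda> \<notin> {y..<y + h}"
  obtains L and k p m n :: int where "h < L" "0 < p" "a = of_int k * L" "\<Lambda> = of_int p * L"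
    "k * m + p * n = 1"
    "\<And>e (i::int). e \<in> E \<Longrightarrow> \<exists>e'\<in>E. \<exists>j::int. e' = e + of_int i * L + of_int j * \<Lambda>"
proof -
  \<comment> \<open>Forward steps use that \<open>f\<close> maps \<open>E\<close> into
    \<open>E\<close>; backward steps use that it maps onto \<open>E\<close>.\<close>
  have shift: "\<exists>e'\<in>E. \<exists>j::int. e' = e + of_int i * a + of_int j * \<Lambda>" if "e \<in> E" for e and i :: int
  proof (induction i rule: int_induct[of _ 0])
    case base
    then show ?case using that by (intro bexI[of _ e] exI[of _ 0]) auto
  next
    case (step1 i)
    then obtain e' j where e': "e' \<in> E" "e' = e + of_int i * a + of_int j * \<Lambda>" by blast
    obtain j' :: int where j': "f e' = e' + a + of_int j' * \<Lambda>" using rot[OF e'(1)] by blast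
    have "f e' = e + of_int (i + 1) * a + of_int (j + j') * \<Lambda>"
      using e' j' by (simp add: algebra_simps)
    moreover have "f e' \<in> E" using imageI[OF e'(1), of f] fE by simp
    ultimately show ?case by blast
  next
    case (step2 i)
    then obtain e' j where e': "e' \<in> E" "e' = e + of_int i * a + of_int j * \<Lambda>" by blast
    then have "e' \<in> f ` E" using fE by simp
    then obtain e'' where e'': "e'' \<in> E" "f e'' = e'" by blast
    obtain j' :: int where j': "f e'' = e'' + a + of_int j' * \<Lambda>" using rot[OF e''(1)] by blast
    have "e'' = e + of_int (i - 1) * a + of_int (j - j') * \<Lambda>"
      using e' j' e'' by (simp add: algebra_simps)
    then show ?case using e'' by blast
  qed
  define \<Gamma> where "\<Gamma> = {of_int i * a + of_int j * \<Lambda> |i j :: int. True}"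
  have \<Gamma>_comb: "x - of_int z * x' \<in> \<Gamma>" if "x \<in> \<Gamma>" "x' \<in> \<Gamma>" for x x' and z :: int
  proof -
    obtain i j i' j' :: int where
      "x = of_int i * a + of_int j * \<Lambda>" "x' = of_int i' * a + of_int j' * \<Lambda>"
      using \<open>x \<in> \<Gamma>\<close> \<open>x' \<in> \<Gamma>\<close> unfolding \<Gamma>_def by auto
    then have "x - of_int z * x' = of_int (i - z * i') * a + of_int (j - z * j') * \<Lambda>"
      by (simp add: algebra_simps)
    then show ?thesis unfolding \<Gamma>_def by blast
  qed
  have move: "\<exists>e'\<in>E. \<exists>j::int. e' = e + of_int i * x + of_int j * \<Lambda>"
    if x: "x \<in> \<Gamma>" and e: "e \<in> E" for x e and i :: int
  proof -
    obtain i' j' :: int where ij: "x = of_int i' * a + of_int j' * \<Lambda>" using x unfolding \<Gamma>_def by auto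
    obtain e' j'' where "e' \<in> E" "e' = e + of_int (i * i') * a + of_int j'' * \<Lambda>"
      using shift[OF e] by blast
    then have "e' = e + of_int i * x + of_int (j'' - i * j') * \<Lambda>"
      unfolding ij by (simp add: algebra_simps)
    then show ?thesis using \<open>e' \<in> E\<close> by blast
  qed
  have gap: "h < x" if x: "x \<in> \<Gamma>" "0 < x" for x
  proof (rule ccontr)
    assume "\<not> h < x"
    obtain e where e: "e \<in> E" using ne by blast
    \<comment> \<open>The least multiple of \<open>x\<close> that carries \<open>e\<close> to
      \<open>y\<close> or beyond overshoots by less than \<open>x\<close>, hence by less than
      \<open>h\<close>, and lands in the avoided interval.\<close>
    define i where "i = \<lceil>(y - e) / x\<rceil>"
    have "(y - e) / x \<le> of_int i" "of_int i < (y - e) / x + 1" unfolding i_def by linarith+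
    then have b: "y - e \<le> of_int i * x" "of_int i * x < y - e + x"
      using x(2) by (simp_all add: field_simps)
    obtain e' j where e': "e' \<in> E" "e' = e + of_int i * x + of_int j * \<Lambda>" using move[OF x(1) e] by blast
    have "e' + of_int (- j) * \<Lambda> \<in> {y..<y + h}" using e' b \<open>\<not> h < x\<close> by auto
    then show False using avoid e'(1) by blast
  qed
  have a\<Gamma>: "a \<in> \<Gamma>" unfolding \<Gamma>_def by (rule CollectI, rule exI[of _ 1], rule exI[of _ 0]) simp
  have \<Lambda>\<Gamma>: "\<Lambda> \<in> \<Gamma>" unfolding \<Gamma>_def by (rule CollectI, rule exI[of _ 0], rule exI[of _ 1]) simp
  \<comment> \<open>Positive reals are not well-ordered, so \<open>\<lfloor>x / h\<rfloor>\<close>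
    is minimised instead. Distinct elements of \<Gamma> differ by more than \<open>h\<close>, so
    this already selects the least positive element.\<close>
  obtain L where L: "L \<in> \<Gamma>" "0 < L" and min: "\<And>x. x \<in> \<Gamma> \<Longrightarrow> 0 < x \<Longrightarrow> nat \<lfloor>L / h\<rfloor> \<le> nat \<lfloor>x / h\<rfloor>"
    using ex_has_least_nat[of "\<lambda>x. x \<in> \<Gamma> \<and> 0 < x" \<Lambda> "\<lambda>x. nat \<lfloor>x / h\<rfloor>"] \<Lambda>\<Gamma> \<Lambda> by blast
  have least: "L \<le> x" if x: "x \<in> \<Gamma>" "0 < x" for x
  proof (rule ccontr)
    assume "\<not> L \<le> x"
    then have d: "h < L - x" using gap[OF \<Gamma>_comb[OF L(1) x(1), of 1]] by simp
    then have "(x + h) / h < L / h" using h by (intro divide_strict_right_mono) auto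
    then have "x / h + 1 < L / h" using h by (simp add: add_divide_distrib)
    then have "\<lfloor>x / h\<rfloor> + 1 \<le> \<lfloor>L / h\<rfloor>" by linarith
    moreover have "0 \<le> \<lfloor>x / h\<rfloor>" using x h by simp
    ultimately show False using min[OF x] by linarith
  qed
  have mult: "\<exists>k::int. x = of_int k * L" if x: "x \<in> \<Gamma>" for x
  proof -
    obtain z :: int and r where zr: "x = of_int z * L + r" "0 \<le> r" "r < L"
      by (rule cell_exists[OF L(2)])
    have "r = x - of_int z * L" using zr by simp
    then have "r \<in> \<Gamma>" using \<Gamma>_comb[OF x L(1)] by simp
    then have "r = 0" using least zr by force
    then show ?thesis using zr by auto
  qed
  obtain k :: int where k: "a = of_int k * L" using mult a\<Gamma> by blast
  obtain p :: int where p: "\<Lambda> = of_int p * L" using mult \<Lambda>\<Gamma> by blast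
  \<comment> \<open>Membership of the generator in the group it generates is the Bezout identity,
    after division by \<open>L\<close>.\<close>
  obtain m n :: int where mn: "L = of_int m * a + of_int n * \<Lambda>" using L(1) unfolding \<Gamma>_def by auto
  have "1 * L = of_int (k * m + p * n) * L"
    using mn unfolding k p by (simp add: algebra_simps)
  then have "(1::real) = of_int (k * m + p * n)" using L(2) by (simp only: mult_cancel_right) simp
  then have bez: "k * m + p * n = 1" by linarith
  have p0: "0 < p" using p \<Lambda> L(2) by (metis of_int_0_less_iff zero_less_mult_pos2)
  show ?thesis
    by (rule that[OF gap[OF L] p0 k p bez]) (use move L in blast)
qed

section \<open>Fractional parts and their left limits\<close>

lemma frac_eqI:
  assumes "0 \<le> x - of_int n" "x - of_int n < (1::real)"
  shows "frac x = x - of_int n"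
  using assms frac_unique_iff[of x "x - of_int n"] by simp

lemma frac_int_diff:
  assumes "frac x = frac (y::real)" obtains n :: int where "x = y + of_int n"
  using that[of "\<lfloor>x\<rfloor> - \<lfloor>y\<rfloor>"] assms unfolding frac_def by simp

lemma frac_range: "0 \<le> frac (x::real)" "frac x < 1"
  by (auto simp: frac_lt_1)

text \<open>The starred fractional part is the left limit of \<open>frac\<close>. The value
  \<open>frac_star x\<close> is the distance from \<open>x\<close> to the largest integer strictly
  below it, and \<open>frac\<close> has slope 1 without a jump in between.\<close>

lemma frac_star_left_limit:
  obtains \<delta> where "0 < \<delta>" "\<And>s. x - \<delta> < s \<Longrightarrow> s < x \<Longrightarrow> frac_star x = frac s + (x - s)"
proof (rule that[of "frac_star x"])
  show "0 < frac_star x" unfolding frac_star_def using frac_range(2)[of "1 - x"] by simp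
  fix s assume s: "x - frac_star x < s" "s < x"
  have "x - frac_star x = of_int (- \<lfloor>1 - x\<rfloor>)" unfolding frac_star_def frac_def by simp
  moreover have "frac_star x \<le> 1" unfolding frac_star_def using frac_range(1)[of "1 - x"] by simp
  ultimately show "frac_star x = frac s + (x - s)"
    using s frac_eqI[of s "- \<lfloor>1 - x\<rfloor>"] by simp
qed

section \<open>The symmetric invariant set\<close>

locale hole_map =
  fixes \<alpha> x1 x2 :: real
  assumes alpha: "0 \<le> \<alpha>" "\<alpha> < 1" and hole: "0 \<le> x1" "x1 < x2" "x2 \<le> 1"
begin

abbreviation "h \<equiv> x2 - x1"
abbreviation "M \<equiv> transf \<alpha> x1 x2"
abbreviation "S \<equiv> max_invariant_set \<alpha> x1 x2"
abbreviation "E \<equiv> sym_max_invariant_set \<alpha> x1 x2"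

definition N :: "real \<Rightarrow> real" where
  "N t = 1 - coherent_transf \<alpha> x1 x2 (1 - t)"

lemma M_left: "0 \<le> t \<Longrightarrow> t < x1 \<Longrightarrow> M t = frac (t + \<alpha> + h)"
  unfolding transf_def by (simp add: algebra_simps)

lemma M_right: "x2 \<le> t \<Longrightarrow> t < 1 \<Longrightarrow> M t = frac (t + \<alpha>)"
  using hole unfolding transf_def by simp

text \<open>Reflection cancels the starred fractional part, so \<open>N\<close> consists of backward
  rotations by the shifts of \<open>M\<close>, the larger one now acting to the right of the
  reflected hole.\<close>

lemma N_right: "1 - x1 \<le> t \<Longrightarrow> t < 1 \<Longrightarrow> N t = frac (t - \<alpha> - h)"
  unfolding N_def coherent_transf_def frac_star_def by (simp add: algebra_simps)

lemma N_left: "0 \<le> t \<Longrightarrow> t < 1 - x2 \<Longrightarrow> N t = frac (t - \<alpha>)"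
  using hole unfolding N_def coherent_transf_def frac_star_def by (simp add: algebra_simps)

lemma M_range: "0 \<le> t \<Longrightarrow> t < 1 \<Longrightarrow> 0 \<le> M t \<and> M t < 1"
  unfolding transf_def by (simp add: frac_range)

lemma N_range: "0 \<le> t \<Longrightarrow> t < 1 \<Longrightarrow> 0 \<le> N t \<and> N t < 1"
  unfolding N_def coherent_transf_def frac_star_def by (simp add: frac_range)

text \<open>Raising the left piece by \<open>h\<close> closes the hole, after which both pieces
  undergo the same rotation by \<alpha>. Equal images on opposite sides would require an integer
  strictly between -1 and 0.\<close>

lemma M_inj:
  assumes "0 \<le> s" "s < 1" "s \<notin> {x1..<x2}" "0 \<le> t" "t < 1" "t \<notin> {x1..<x2}" "M s = M t"
  shows "s = t"
proof -
  have *: False if "0 \<le> s" "s < x1" "x2 \<le> t" "t < 1" "M s = M t" for s t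
  proof -
    have "frac (s + \<alpha> + h) = frac (t + \<alpha>)" using that M_left M_right by simp
    then obtain n :: int where "s + \<alpha> + h = t + \<alpha> + of_int n" by (rule frac_int_diff)
    then have "real_of_int (- 1) < real_of_int n" "real_of_int n < real_of_int 0"
      using that hole by auto
    then show False unfolding of_int_less_iff by linarith
  qed
  have **: "s = t" if d: "\<bar>s - t\<bar> < 1" "frac (s + c) = frac (t + c)" for s t c :: real
  proof -
    obtain n :: int where n: "s + c = t + c + of_int n" using d(2) by (rule frac_int_diff)
    then have "real_of_int (- 1) < real_of_int n" "real_of_int n < real_of_int 1"
      using d(1) by auto
    then have "n = 0" unfolding of_int_less_iff by linarith
    then show ?thesis using n by simp
  qed
  consider "s < x1" "t < x1" | "x2 \<le> s" "x2 \<le> t" | "s < x1" "x2 \<le> t" | "x2 \<le> s" "t < x1"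
    using assms by fastforce
  then show ?thesis
  proof cases
    case 1
    then show ?thesis using assms M_left **[of s t "\<alpha> + h"] by (simp add: add.assoc)
  next
    case 2
    then show ?thesis using assms M_right **[of s t \<alpha>] by simp
  next
    case 3
    then show ?thesis using *[of s t] assms by blast
  next
    case 4
    then show ?thesis using *[of t s] assms by simp
  qed
qed

lemma M_S: "M ` S = S" "S \<subseteq> {0..<1} - {x1..<x2}"
  using max_invariant_set_greatest(1)[of \<alpha> x1 x2] unfolding invariant_off_hole_def by simp_all

text \<open>Conjugation by the reflection puts all conditions on \<open>[0,1)\<close>: the coherent
  map becomes \<open>N\<close>, and the mirrored hole becomes left-closed.\<close>

lemma sym_invariant_iff:
  "sym_invariant_off_hole \<alpha> x1 x2 D \<longleftrightarrow>
     D \<subseteq> {0..<1} - ({x1..<x2} \<union> {1 - x2..<1 - x1}) \<and> M ` D = D \<and> N ` D = D"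
proof -
  have "reflect {x1<..x2} = {1 - x2..<1 - x1}"
  proof (intro equalityI subsetI)
    fix t assume "t \<in> {1 - x2..<1 - x1}"
    then show "t \<in> reflect {x1<..x2}" unfolding reflect_def by (intro image_eqI[of _ _ "1 - t"]) auto
  qed (auto simp: reflect_def)
  moreover have "N ` D = reflect (coherent_transf \<alpha> x1 x2 ` reflect D)"
    unfolding N_def reflect_def image_image ..
  moreover have "reflect A = D \<longleftrightarrow> A = reflect D" for A
    unfolding reflect_def by (force simp: image_iff)
  ultimately show ?thesis unfolding sym_invariant_off_hole_def by simp
qed

section \<open>The two maps are mutually inverse on the symmetric invariant set\<close>

lemma M_E: "M ` E = E" and N_E: "N ` E = E"
  and E_subset: "E \<subseteq> {0..<1} - ({x1..<x2} \<union> {1 - x2..<1 - x1})"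
  using sym_max_invariant_set_greatest(1)[of \<alpha> x1 x2] unfolding sym_invariant_iff by simp_all

lemma E_props:
  assumes "e \<in> E"
  shows "0 \<le> e" "e < 1" "e < x1 \<or> x2 \<le> e" "e < 1 - x2 \<or> 1 - x1 \<le> e" "M e \<in> E" "N e \<in> E"
  using subsetD[OF E_subset assms] imageI[OF assms, of M] imageI[OF assms, of N]
  unfolding M_E N_E by auto

text \<open>If \<open>N e\<close> lay left of the hole, \<open>M \<circ> N\<close> would translate \<open>e\<close> by \<open>h\<close> upwards, again into \<open>E\<close>, without ever being
  able to jump over the reflected hole; similarly downwards below.\<close>

lemma N_E_left:
  assumes "e \<in> E" "e < 1 - x2"
  shows "x2 \<le> N e"
proof (rule ccontr)
  assume "\<not> x2 \<le> N e"
  then have bad: "N e < x1" using E_props(3)[OF E_props(6)[OF assms(1)]] by simp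
  have step: "t + h \<in> E \<and> t + h < 1 - x2 \<and> N (t + h) < x1" if t: "t \<in> E" "t < 1 - x2" "N t < x1" for t
  proof -
    note Et = E_props[OF t(1)] and ENt = E_props[OF E_props(6)[OF t(1)]]
    have Nt: "N t = frac (t - \<alpha>)" using N_left t Et by simp
    have "M (N t) = frac (frac (t - \<alpha>) + \<alpha> + h)" using M_left ENt t Nt by simp
    also have "\<dots> = t + h"
      using frac_eqI[of "frac (t - \<alpha>) + \<alpha> + h" "- \<lfloor>t - \<alpha>\<rfloor>"] Et t hole by (simp add: frac_def)
    finally have MN: "M (N t) = t + h" .
    then have th: "t + h \<in> E" using ENt by simp
    \<comment> \<open>The reflected hole has length \<open>h\<close> and is missed by
      \<open>E\<close>, so a step of length \<open>h\<close> from below it cannot cross it.\<close>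
    then have lt: "t + h < 1 - x2" using E_props(4)[OF th] t by linarith
    have Nth: "N (t + h) = frac (t + h - \<alpha>)" using N_left lt E_props(1)[OF th] by simp
    \<comment> \<open>Otherwise the two rotations would cancel at \<open>t + h\<close>, giving
      \<open>N (t + h)\<close> and \<open>N t\<close> the same image under \<open>M\<close> although
      they lie on different sides of the hole.\<close>
    have "\<not> x2 \<le> N (t + h)"
    proof
      assume V: "x2 \<le> N (t + h)"
      note ENth = E_props[OF E_props(6)[OF th]]
      have "M (N (t + h)) = frac (frac (t + h - \<alpha>) + \<alpha>)" using M_right V ENth Nth by simp
      also have "\<dots> = t + h"
        using frac_eqI[of "frac (t + h - \<alpha>) + \<alpha>" "- \<lfloor>t + h - \<alpha>\<rfloor>"] E_props[OF th] by (simp add: frac_def)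
      finally have "M (N (t + h)) = M (N t)" using MN by simp
      then have "N (t + h) = N t" using M_inj[of "N (t + h)" "N t"] ENth ENt by auto
      then show False using t(3) V hole by simp
    qed
    then show ?thesis using th lt E_props(3)[OF E_props(6)[OF th]] by auto
  qed
  obtain n where n: "1 < real n * h" using reals_Archimedean3[of h] hole by auto
  have "e + real n * h \<in> E \<and> e + real n * h < 1 - x2 \<and> N (e + real n * h) < x1" for n
  proof (induction n)
    case 0
    then show ?case using assms bad by simp
  next
    case (Suc n)
    then show ?case using step[of "e + real n * h"] by (simp add: algebra_simps)
  qed
  then have "e + real n * h < 1 - x2" by blast
  then show False using n E_props(1)[OF assms(1)] hole by linarith
qed

lemma N_E_right:
  assumes "e \<in> E" "1 - x1 \<le> e"
  shows "N e < x1"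
proof (rule ccontr)
  assume "\<not> N e < x1"
  then have bad: "x2 \<le> N e" using E_props(3)[OF E_props(6)[OF assms(1)]] by simp
  have step: "t - h \<in> E \<and> 1 - x1 \<le> t - h \<and> x2 \<le> N (t - h)" if t: "t \<in> E" "1 - x1 \<le> t" "x2 \<le> N t" for t
  proof -
    note Et = E_props[OF t(1)] and ENt = E_props[OF E_props(6)[OF t(1)]]
    have Nt: "N t = frac (t - \<alpha> - h)" using N_right t Et by simp
    have "M (N t) = frac (frac (t - \<alpha> - h) + \<alpha>)" using M_right ENt t Nt by simp
    also have "\<dots> = t - h"
      using frac_eqI[of "frac (t - \<alpha> - h) + \<alpha>" "- \<lfloor>t - \<alpha> - h\<rfloor>"] Et t hole by (simp add: frac_def)
    finally have MN: "M (N t) = t - h" .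
    then have th: "t - h \<in> E" using ENt by simp
    then have ge: "1 - x1 \<le> t - h" using E_props(4)[OF th] t by linarith
    have Nth: "N (t - h) = frac (t - h - \<alpha> - h)" using N_right ge E_props(2)[OF th] by simp
    \<comment> \<open>Again \<open>M\<close> would send \<open>N (t - h)\<close> and
      \<open>N t\<close>, on different sides of the hole, to the same point.\<close>
    have "\<not> N (t - h) < x1"
    proof
      assume U: "N (t - h) < x1"
      note ENth = E_props[OF E_props(6)[OF th]]
      have "M (N (t - h)) = frac (frac (t - h - \<alpha> - h) + \<alpha> + h)" using M_left U ENth Nth by simp
      also have "\<dots> = t - h"
        using frac_eqI[of "frac (t - h - \<alpha> - h) + \<alpha> + h" "- \<lfloor>t - h - \<alpha> - h\<rfloor>"] E_props[OF th]
        by (simp add: frac_def)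
      finally have "M (N (t - h)) = M (N t)" using MN by simp
      then have "N (t - h) = N t" using M_inj[of "N (t - h)" "N t"] ENth ENt by auto
      then show False using t(3) U hole by simp
    qed
    then show ?thesis using th ge E_props(3)[OF E_props(6)[OF th]] by auto
  qed
  obtain n where n: "1 < real n * h" using reals_Archimedean3[of h] hole by auto
  have "e - real n * h \<in> E \<and> 1 - x1 \<le> e - real n * h \<and> x2 \<le> N (e - real n * h)" for n
  proof (induction n)
    case 0
    then show ?case using assms bad by simp
  next
    case (Suc n)
    then show ?case using step[of "e - real n * h"] by (simp add: algebra_simps)
  qed
  then have "1 - x1 \<le> e - real n * h" by blast
  then show False using n E_props(2)[OF assms(1)] hole by linarith
qed

text \<open>\<open>N\<close> carries each side of the reflected hole to the opposite side of the
  hole, which is where \<open>M\<close> applies exactly the reverse shift.\<close>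

lemma M_N_E:
  assumes "e \<in> E"
  shows "M (N e) = e"
proof -
  note Ee = E_props[OF assms] and EN = E_props[OF E_props(6)[OF assms]]
  show ?thesis
  proof (cases "e < 1 - x2")
    case True
    then have "x2 \<le> N e" using N_E_left assms by blast
    then have "M (N e) = frac (frac (e - \<alpha>) + \<alpha>)"
      using M_right[OF _ EN(2)] N_left[OF Ee(1) True] by simp
    then show ?thesis
      using frac_eqI[of "frac (e - \<alpha>) + \<alpha>" "- \<lfloor>e - \<alpha>\<rfloor>"] Ee by (simp add: frac_def)
  next
    case False
    then have "1 - x1 \<le> e" using Ee by simp
    then have "N e < x1" using N_E_right assms by blast
    then have "M (N e) = frac (frac (e - \<alpha> - h) + \<alpha> + h)"
      using M_left[OF EN(1)] N_right[OF \<open>1 - x1 \<le> e\<close> Ee(2)] by simp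
    then show ?thesis
      using frac_eqI[of "frac (e - \<alpha> - h) + \<alpha> + h" "- \<lfloor>e - \<alpha> - h\<rfloor>"] Ee by (simp add: frac_def)
  qed
qed

text \<open>As \<open>N\<close> maps \<open>E\<close> onto \<open>E\<close>, its left inverse
  \<open>M\<close> is also a right inverse.\<close>

lemma N_M_E:
  assumes "e \<in> E"
  shows "N (M e) = e"
proof -
  have "e \<in> N ` E" using assms N_E by simp
  then obtain e' where "e' \<in> E" "e = N e'" by blast
  then show ?thesis using M_N_E by simp
qed

text \<open>If \<open>M e\<close> lay left of the reflected hole, \<open>N_E_left\<close> would put
  \<open>N (M e) = e\<close> to the right of the hole.\<close>

lemma M_E_left:
  assumes "e \<in> E" "e < x1"
  shows "1 - x1 \<le> M e"
  using N_E_left[OF E_props(5)[OF assms(1)]] N_M_E[OF assms(1)] assms(2) hole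
    E_props(4)[OF E_props(5)[OF assms(1)]] by linarith

lemma M_E_right:
  assumes "e \<in> E" "x2 \<le> e"
  shows "M e < 1 - x2"
  using N_E_right[OF E_props(5)[OF assms(1)]] N_M_E[OF assms(1)] assms(2) hole
    E_props(4)[OF E_props(5)[OF assms(1)]] by linarith

text \<open>The coherent map is the left limit of \<open>M\<close>, so a rotation known for
  \<open>M\<close> slightly to the left of \<open>t\<close> determines its value at
  \<open>t\<close>.\<close>

lemma coherent_left_limit:
  assumes "0 < t" "t \<le> 1"
  obtains \<delta> where "0 < \<delta>"
    "\<And>s. t - \<delta> < s \<Longrightarrow> s < t \<Longrightarrow> coherent_transf \<alpha> x1 x2 t = M s + (t - s)"
proof (cases "t \<le> x1 \<or> x2 < t")
  case True
  \<comment> \<open>\<open>c\<close> is the shift on the piece containing \<open>t\<close>, and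
    \<open>y\<close> is the left end of that piece, below which \<open>s\<close> must not
    fall.\<close>
  define c where "c = (if t \<le> x1 then \<alpha> + h else \<alpha>)"
  define y where "y = (if t \<le> x1 then 0 else x2)"
  obtain \<delta> where \<delta>: "0 < \<delta>" "\<And>s. t + c - \<delta> < s \<Longrightarrow> s < t + c \<Longrightarrow> frac_star (t + c) = frac s + (t + c - s)"
    using frac_star_left_limit[of "t + c"] by blast
  have C: "coherent_transf \<alpha> x1 x2 t = frac_star (t + c)"
    using True assms hole by (auto simp: coherent_transf_def c_def algebra_simps)
  show ?thesis
  proof (rule that[of "min \<delta> (t - y)"])
    show "0 < min \<delta> (t - y)" using \<delta>(1) True assms by (auto simp: y_def)
    fix s assume s: "t - min \<delta> (t - y) < s" "s < t"
    then have "y < s" "t + c - \<delta> < s + c" "s + c < t + c" by auto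
    moreover have "M s = frac (s + c)"
      using \<open>y < s\<close> s(2) True assms M_left[of s] M_right[of s]
      by (auto simp: y_def c_def add.assoc split: if_splits)
    ultimately show "coherent_transf \<alpha> x1 x2 t = M s + (t - s)" unfolding C using \<delta>(2)[of "s + c"] by simp
  qed
next
  case False
  then show ?thesis
    using that[of "t - x1"] assms by (auto simp: coherent_transf_def transf_def)
qed

section \<open>The maximal invariant set\<close>

text \<open>The circle exceeds the unit interval by \<beta>, and the hole starts at offset \<xi> of
  cell \<open>j\<close> and ends within that cell. Points of the cell above the hole lose
  \<open>h\<close> against the rotation, so every orbit with offset at least \<xi> would sink into
  the hole. Offsets below \<xi> merely rotate; they fit into the shortened last cell since \<xi> is
  at most \<open>L - \<beta>\<close>.\<close>

lemma S_eq_cells_above_gap: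
  fixes p k m n j :: int and L \<beta> \<xi> :: real
  assumes L: "0 < L" and p: "0 < p" and bez: "k * m + p * n = 1"
    and \<beta>: "0 \<le> \<beta>" "1 = of_int p * L - \<beta>"
    and \<xi>: "0 < \<xi>" "\<xi> + h \<le> L" "\<xi> \<le> L - \<beta>"
    and j: "0 \<le> j" "j < p" "x1 = of_int j * L + \<xi>"
    and good: "\<And>t. 0 \<le> t \<and> t < x1 \<or> of_int (j + 1) * L \<le> t \<and> t < 1 \<Longrightarrow>
      \<exists>n::int. M t = t + of_int k * L + of_int n * (of_int p * L)"
    and drop: "\<And>t. x2 \<le> t \<Longrightarrow> t < of_int (j + 1) * L \<Longrightarrow> t < 1 \<Longrightarrow>
      \<exists>n::int. M t = t + of_int k * L - h + of_int n * (of_int p * L)"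
  shows "S = cells p L 0 \<xi>"
    and "\<And>t. t \<in> S \<Longrightarrow> \<exists>n::int. M t = t + of_int k * L + of_int n * (of_int p * L)"
proof -
  let ?T = "cells p L 0 \<xi>"
  have x2: "x2 = of_int j * L + \<xi> + h" using j by simp
  have idx_good: "zL + r < x1" if "zL = of_int z * L" "z < j \<or> z = j \<and> r < \<xi>" "r < L" for zL r and z :: int
  proof (cases "z = j")
    case False
    then have "of_int (z + 1) * L \<le> of_int j * L" using that L by (intro mult_right_mono) auto
    then show ?thesis using that j \<xi> by (simp add: algebra_simps)
  qed (use that j in auto)
  have idx_high: "of_int (j + 1) * L \<le> of_int z * L" if "j < z" for z :: int
    using that L by (intro mult_right_mono) auto
  have T: "0 \<le> t \<and> t < 1 \<and> (t < x1 \<or> of_int (j + 1) * L \<le> t)" if t: "t \<in> ?T" for t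
  proof -
    obtain i r where ir: "0 \<le> i" "i < p" "0 \<le> r" "r < \<xi>" "t = of_int i * L + r"
      using t unfolding cells_iff by blast
    have "of_int (i + 1) * L \<le> of_int p * L" using ir L by (intro mult_right_mono) auto
    then have "t < 1" using ir \<beta> \<xi> by (simp add: algebra_simps)
    moreover have "0 \<le> t" using ir L by simp
    moreover have "t < x1 \<or> of_int (j + 1) * L \<le> t"
    proof (cases "i \<le> j")
      case True
      then have "i < j \<or> i = j \<and> r < \<xi>" "r < L" using ir \<xi> hole by auto
      then show ?thesis using idx_good[OF refl, of i r] ir by simp
    next
      case False
      then show ?thesis using idx_high[of i] ir by simp
    qed
    ultimately show ?thesis by blast
  qed
  have "M ` ?T = ?T"
  proof (rule cells_rotation[OF L p, where k = k])
    show "\<xi> \<le> L" using \<xi> hole by linarith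
    fix t assume t: "t \<in> ?T"
    show "0 \<le> M t \<and> M t < of_int p * L \<and>
        (\<exists>n::int. M t = t + of_int k * L + of_int n * (of_int p * L))"
      using T[OF t] good[of t] M_range[of t] \<beta> by auto
  qed simp
  moreover have "?T \<subseteq> {0..<1} - {x1..<x2}"
  proof
    fix t assume t: "t \<in> ?T"
    have "x2 \<le> of_int (j + 1) * L" using x2 \<xi> by (simp add: algebra_simps)
    then show "t \<in> {0..<1} - {x1..<x2}" using T[OF t] by auto
  qed
  ultimately have "?T \<subseteq> S" by (intro max_invariant_set_greatest(2)) (simp add: invariant_off_hole_def)
  define idx where "idx t = \<lfloor>t / L\<rfloor>" for t
  \<comment> \<open>The excess of the offset over the threshold is the height that drops by
    \<open>h\<close> at each passage through cell \<open>j\<close>.\<close>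
  define v where "v t = t - of_int (idx t) * L - \<xi>" for t
  have vi: "idx t = z \<and> v t = r - \<xi>" if "t = of_int z * L + r" "0 \<le> r" "r < L" for t z r
  proof -
    have "idx t = z" unfolding idx_def that(1) by (rule floor_cell[OF L that(2,3)])
    then show ?thesis using that(1) by (simp add: v_def)
  qed
  have X: "M t \<in> S - ?T \<and> 0 \<le> v t \<and> idx (M t) mod p = (idx t + k) mod p \<and>
      v (M t) = v t - (if idx t = j then h else 0) \<and> 0 \<le> idx t \<and> idx t < p"
    if t: "t \<in> S - ?T" for t
  proof -
    have t01: "0 \<le> t" "t < 1" "t < x1 \<or> x2 \<le> t" using t M_S(2) by force+
    obtain z :: int and r where zr: "t = of_int z * L + r" "0 \<le> r" "r < L" by (rule cell_exists[OF L])
    have z: "0 \<le> z" "z < p" using cell_index_range[OF L zr(2,3), of z p] zr t01 \<beta> by auto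
    have r: "\<xi> \<le> r"
    proof (rule ccontr)
      assume "\<not> \<xi> \<le> r"
      then have "t \<in> ?T" using zr z unfolding cells_iff by (intro exI[of _ z] exI[of _ r]) auto
      then show False using t by blast
    qed
    define r' where "r' = r - (if z = j then h else 0)"
    \<comment> \<open>In cell \<open>j\<close> a point of \<open>S\<close> with offset at least
      \<xi> must lie beyond the hole, so its offset is at least \<open>\<xi> + h\<close> and stays
      at or above \<xi> after the drop.\<close>
    have r': "\<xi> \<le> r'" "r' < L"
      using r zr hole t01 j x2 by (auto simp: r'_def)
    have "\<exists>n::int. M t = of_int z * L + r' + of_int k * L + of_int n * (of_int p * L)"
    proof (cases "z = j")
      case True
      then have "x2 \<le> t" "t < of_int (j + 1) * L" using zr r t01 j by (auto simp: algebra_simps)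
      from drop[OF this t01(2)] show ?thesis using True zr by (simp add: r'_def algebra_simps)
    next
      case False
      then have "0 \<le> t \<and> t < x1 \<or> of_int (j + 1) * L \<le> t \<and> t < 1"
      proof (cases "z < j")
        case True
        then show ?thesis using idx_good[OF refl, of z r] zr t01 by simp
      next
        case False
        then have "j < z" using \<open>z \<noteq> j\<close> by simp
        from idx_high[OF this] have "of_int (j + 1) * L \<le> t" using zr(1,2) by linarith
        then show ?thesis using t01 by blast
      qed
      from good[OF this] show ?thesis using False zr by (simp add: r'_def)
    qed
    then obtain n :: int where n: "M t = of_int z * L + r' + of_int k * L + of_int n * (of_int p * L)" ..
    then have Mt: "M t = of_int (z + k + n * p) * L + r'" by (simp add: algebra_simps)
    have Mvi: "idx (M t) = z + k + n * p" "v (M t) = r' - \<xi>" using vi[OF Mt] r' \<xi> by auto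
    have "M t \<notin> ?T"
    proof
      assume "M t \<in> ?T"
      then obtain i s where cell: "0 \<le> s" "s < \<xi>" "M t = of_int i * L + s" unfolding cells_iff by blast
      then have "v (M t) = s - \<xi>" using vi[OF cell(3)] \<xi> hole by auto
      then show False using Mvi cell r' by simp
    qed
    moreover have "M t \<in> S" using t M_S(1) imageI[of t S M] by simp
    ultimately show ?thesis using Mvi vi[OF zr] r z by (simp add: r'_def)
  qed
  have "S - ?T = {}"
  proof (rule no_trapped_points[OF p _ bez, where f = M and v = v and idx = idx and h = h and j = j])
    fix t assume t: "t \<in> S - ?T"
    note X = X[OF t]
    show "M t \<in> S - ?T" "0 \<le> v t" using X by blast+
    have "idx t mod p = j mod p \<longleftrightarrow> idx t = j" using X j by simp
    then show "idx t mod p = j mod p \<Longrightarrow> v (M t) \<le> v t - h"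
      and "idx t mod p \<noteq> j mod p \<Longrightarrow> v (M t) \<le> v t \<and> idx (M t) mod p = (idx t + k) mod p"
      using X by auto
  qed (use hole in simp)
  then show S: "S = ?T" using \<open>?T \<subseteq> S\<close> by blast
  show "\<exists>n::int. M t = t + of_int k * L + of_int n * (of_int p * L)" if "t \<in> S" for t
    using good[of t] T[of t] that unfolding S by auto
qed

text \<open>Here cells are measured from -\<beta>, and the hole ends at offset \<omega> of cell
  \<open>j\<close>. Points of this cell below the hole gain \<open>h\<close>, so orbits with offset
  below \<omega> would rise into the hole and only the offsets from \<omega> to \<open>L\<close>
  survive. Undoing the displacement by \<beta> gives the stated cells; as \<beta> is at most
  \<omega>, they do not extend below 0.\<close>

lemma S_eq_cells_below_gap:
  fixes p k m n j :: int and L \<beta> \<omega> :: real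
  assumes L: "0 < L" and p: "0 < p" and bez: "k * m + p * n = 1"
    and \<beta>: "0 \<le> \<beta>" "\<beta> \<le> \<omega>" "1 = of_int p * L - \<beta>"
    and \<omega>: "h \<le> \<omega>" "\<omega> < L"
    and j: "0 \<le> j" "j < p" "x2 = of_int j * L - \<beta> + \<omega>"
    and good: "\<And>t. 0 \<le> t \<and> t < of_int j * L - \<beta> \<or> x2 \<le> t \<and> t < 1 \<Longrightarrow>
      \<exists>n::int. M t = t + of_int k * L + of_int n * (of_int p * L)"
    and rise: "\<And>t. of_int j * L - \<beta> \<le> t \<Longrightarrow> 0 \<le> t \<Longrightarrow> t < x1 \<Longrightarrow>
      \<exists>n::int. M t = t + of_int k * L + h + of_int n * (of_int p * L)"
  shows "S = cells p L (\<omega> - \<beta>) (L - \<beta>)"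
    and "\<And>t. t \<in> S \<Longrightarrow> \<exists>n::int. M t = t + of_int k * L + of_int n * (of_int p * L)"
proof -
  let ?T = "cells p L (\<omega> - \<beta>) (L - \<beta>)"
  have idx_low: "of_int z * L + r < of_int j * L" if "z < j" "r < L" for z :: int and r
  proof -
    have "of_int (z + 1) * L \<le> of_int j * L" using that L by (intro mult_right_mono) auto
    then show ?thesis using that by (simp add: algebra_simps)
  qed
  have idx_high: "x2 + \<beta> \<le> of_int z * L + r" if "j < z \<or> z = j \<and> \<omega> \<le> r" "0 \<le> r" for z :: int and r
  proof (cases "z = j")
    case False
    then have "of_int (j + 1) * L \<le> of_int z * L" using that L by (intro mult_right_mono) auto
    then show ?thesis using that j \<omega> by (simp add: algebra_simps)
  qed (use that j in auto)
  have T: "0 \<le> t \<and> t < 1 \<and> (t < of_int j * L - \<beta> \<or> x2 \<le> t)" if t: "t \<in> ?T" for t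
  proof -
    obtain i r where ir: "0 \<le> i" "i < p" "\<omega> - \<beta> \<le> r" "r < L - \<beta>" "t = of_int i * L + r"
      using t unfolding cells_iff by blast
    have "of_int (i + 1) * L \<le> of_int p * L" using ir L by (intro mult_right_mono) auto
    then have "t < 1" using ir \<beta> by (simp add: algebra_simps)
    moreover have "0 \<le> of_int i * L" using ir L by simp
    then have "0 \<le> t" using ir \<beta> by linarith
    moreover have "t < of_int j * L - \<beta> \<or> x2 \<le> t"
    proof (cases "i < j")
      case True
      then show ?thesis using idx_low[of i "r + \<beta>"] ir by simp
    next
      case False
      then have "j < i \<or> i = j \<and> \<omega> \<le> r + \<beta>" "0 \<le> r + \<beta>" using ir \<beta> by auto
      then show ?thesis using idx_high[of i "r + \<beta>"] ir by simp
    qed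
    ultimately show ?thesis by blast
  qed
  have "M ` ?T = ?T"
  proof (rule cells_rotation[OF L p, where k = k])
    show "0 \<le> \<omega> - \<beta>" "L - \<beta> \<le> L" using \<beta> by linarith+
    fix t assume t: "t \<in> ?T"
    show "0 \<le> M t \<and> M t < of_int p * L \<and>
        (\<exists>n::int. M t = t + of_int k * L + of_int n * (of_int p * L))"
      using T[OF t] good[of t] M_range[of t] \<beta> by auto
  qed
  moreover have "?T \<subseteq> {0..<1} - {x1..<x2}"
  proof
    fix t assume t: "t \<in> ?T"
    have "of_int j * L - \<beta> \<le> x1" using j \<omega> by simp
    then show "t \<in> {0..<1} - {x1..<x2}" using T[OF t] by auto
  qed
  ultimately have "?T \<subseteq> S" by (intro max_invariant_set_greatest(2)) (simp add: invariant_off_hole_def)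
  \<comment> \<open>Adding \<beta> accounts for the first cell, which begins at -\<beta>;
    \<open>v\<close> is then the depth below the threshold \<omega>.\<close>
  define idx where "idx t = \<lfloor>(t + \<beta>) / L\<rfloor>" for t
  define v where "v t = \<omega> - (t + \<beta> - of_int (idx t) * L)" for t
  have vi: "idx t = z \<and> v t = \<omega> - r" if "t + \<beta> = of_int z * L + r" "0 \<le> r" "r < L" for t z r
  proof -
    have "idx t = z" unfolding idx_def that(1) by (rule floor_cell[OF L that(2,3)])
    then show ?thesis using that(1) by (simp add: v_def)
  qed
  have X: "M t \<in> S - ?T \<and> 0 \<le> v t \<and> idx (M t) mod p = (idx t + k) mod p \<and>
      v (M t) = v t - (if idx t = j then h else 0) \<and> 0 \<le> idx t \<and> idx t < p"
    if t: "t \<in> S - ?T" for t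
  proof -
    have t01: "0 \<le> t" "t < 1" "t < x1 \<or> x2 \<le> t" using t M_S(2) by force+
    obtain z :: int and r where zr: "t + \<beta> = of_int z * L + r" "0 \<le> r" "r < L" by (rule cell_exists[OF L])
    have z: "0 \<le> z" "z < p" using cell_index_range[OF L zr(2,3), of z p] zr t01 \<beta> by auto
    have r: "r < \<omega>"
    proof (rule ccontr)
      assume "\<not> r < \<omega>"
      then have "t \<in> ?T" using zr z unfolding cells_iff by (intro exI[of _ z] exI[of _ "r - \<beta>"]) auto
      then show False using t by blast
    qed
    define r' where "r' = r + (if z = j then h else 0)"
    \<comment> \<open>In cell \<open>j\<close> an offset below \<omega> outside the hole is even
      below \<open>\<omega> - h\<close>, so it stays below \<omega> after the rise.\<close>
    have r': "0 \<le> r'" "r' < \<omega>"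
      using r zr hole t01 j by (auto simp: r'_def)
    have "\<exists>n::int. M t + \<beta> = of_int z * L + r' + of_int k * L + of_int n * (of_int p * L)"
    proof (cases "z = j")
      case True
      then have "of_int j * L - \<beta> \<le> t" "t < x1" using zr r t01 j by auto
      from rise[OF this(1) t01(1) this(2)] obtain n :: int
        where "M t = t + of_int k * L + h + of_int n * (of_int p * L)" ..
      then have "M t + \<beta> = of_int z * L + r' + of_int k * L + of_int n * (of_int p * L)"
        using zr(1) True by (simp add: r'_def)
      then show ?thesis ..
    next
      case False
      then have "0 \<le> t \<and> t < of_int j * L - \<beta> \<or> x2 \<le> t \<and> t < 1"
      proof (cases "z < j")
        case True
        then show ?thesis using idx_low[of z r] zr t01 by simp
      next
        case False
        then have "j < z \<or> z = j \<and> \<omega> \<le> r" using \<open>z \<noteq> j\<close> by simp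
        from idx_high[OF this zr(2)] show ?thesis using zr t01 by simp
      qed
      from good[OF this] obtain n :: int
        where "M t = t + of_int k * L + of_int n * (of_int p * L)" ..
      then have "M t + \<beta> = of_int z * L + r' + of_int k * L + of_int n * (of_int p * L)"
        using zr(1) False by (simp add: r'_def)
      then show ?thesis ..
    qed
    then obtain n :: int where n: "M t + \<beta> = of_int z * L + r' + of_int k * L + of_int n * (of_int p * L)" ..
    then have Mt: "M t + \<beta> = of_int (z + k + n * p) * L + r'" by (simp add: algebra_simps)
    have Mvi: "idx (M t) = z + k + n * p" "v (M t) = \<omega> - r'" using vi[OF Mt] r' \<omega> by auto
    have "M t \<notin> ?T"
    proof
      assume "M t \<in> ?T"
      then obtain i s where cell: "\<omega> - \<beta> \<le> s" "s < L - \<beta>" "M t = of_int i * L + s" unfolding cells_iff by blast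
      then have "v (M t) = \<omega> - (s + \<beta>)" using vi[of "M t" i "s + \<beta>"] \<beta> by auto
      then show False using Mvi cell r' by simp
    qed
    moreover have "M t \<in> S" using t M_S(1) imageI[of t S M] by simp
    ultimately show ?thesis using Mvi vi[OF zr] r z by (simp add: r'_def)
  qed
  have "S - ?T = {}"
  proof (rule no_trapped_points[OF p _ bez, where f = M and v = v and idx = idx and h = h and j = j])
    fix t assume t: "t \<in> S - ?T"
    note X = X[OF t]
    show "M t \<in> S - ?T" "0 \<le> v t" using X by blast+
    have "idx t mod p = j mod p \<longleftrightarrow> idx t = j" using X j by simp
    then show "idx t mod p = j mod p \<Longrightarrow> v (M t) \<le> v t - h"
      and "idx t mod p \<noteq> j mod p \<Longrightarrow> v (M t) \<le> v t \<and> idx (M t) mod p = (idx t + k) mod p"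
      using X by auto
  qed (use hole in simp)
  then show S: "S = ?T" using \<open>?T \<subseteq> S\<close> by blast
  show "\<exists>n::int. M t = t + of_int k * L + of_int n * (of_int p * L)" if "t \<in> S" for t
    using good[of t] T[of t] that unfolding S by auto
qed

section \<open>From the cells of the maximal set to the symmetric set\<close>

text \<open>The reflection sends cell \<open>i\<close> to cell \<open>p - 1 - i\<close> and offset
  \<open>r\<close> to \<open>L - \<beta> - r\<close>, which makes the intersection a union of cells
  again. \<open>M\<close> rotates it by \<open>k\<close> cells and \<open>N\<close>, through left
  limits of \<open>M\<close> on \<open>S\<close>, by \<open>-k\<close>, so it is contained in
  \<open>E\<close>; the last hypothesis is the converse.\<close>

lemma E_eq_if_S_eq_cells:
  fixes p k :: int and L \<beta> a b :: real
  assumes L: "0 < L" and p: "0 < p" and \<beta>: "0 \<le> \<beta>" "1 = of_int p * L - \<beta>"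
    and ab: "0 \<le> a" "a < b" "b \<le> L - \<beta>"
    and S: "S = cells p L a b"
    and rot: "\<And>t. t \<in> S \<Longrightarrow> \<exists>n::int. M t = t + of_int k * L + of_int n * (of_int p * L)"
    and E: "E \<subseteq> cells p L (max a (L - \<beta> - b)) (min b (L - \<beta> - a))"
  shows "E = S \<inter> reflect (flip_ends S)"
proof -
  let ?D = "cells p L (max a (L - \<beta> - b)) (min b (L - \<beta> - a))"
  have last: "of_int (i + 1) * L \<le> of_int p * L" if "i < p" for i :: int
    using that L by (intro mult_right_mono) auto
  have "interval_decomp ((\<lambda>i. (of_int i * L + a, of_int i * L + b)) ` {0..<p}) S"
    unfolding interval_decomp_def
  proof (intro conjI ballI)
    fix cd assume "cd \<in> (\<lambda>i. (of_int i * L + a, of_int i * L + b)) ` {0..<p}"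
    then obtain i where i: "0 \<le> i" "i < p" "cd = (of_int i * L + a, of_int i * L + b)" by auto
    have "0 \<le> of_int i * L" using i L by simp
    then show "case cd of (c, d) \<Rightarrow> 0 \<le> c \<and> c < d \<and> d \<le> 1"
      using last[OF i(2)] i(3) ab \<beta> by (simp add: algebra_simps)
  qed (auto simp: S cells_def)
  from flip_ends_eq[OF this]
  have flip: "flip_ends S = (\<Union>i\<in>{0..<p}. {of_int i * L + a<..of_int i * L + b})" by simp
  have D_flip: "\<exists>i r. 0 \<le> i \<and> i < p \<and> a < r \<and> r \<le> b \<and> 1 - t = of_int i * L + r" if "t \<in> ?D" for t
  proof -
    obtain i r where ir: "0 \<le> i" "i < p" "max a (L - \<beta> - b) \<le> r" "r < min b (L - \<beta> - a)"
      "t = of_int i * L + r" using \<open>t \<in> ?D\<close> unfolding cells_iff by blast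
    have "1 - t = of_int (p - 1 - i) * L + (L - \<beta> - r)" using \<beta> ir by (simp add: algebra_simps)
    then show ?thesis using ir by (intro exI[of _ "p - 1 - i"] exI[of _ "L - \<beta> - r"]) auto
  qed
  have D: "S \<inter> reflect (flip_ends S) = ?D"
  proof (intro equalityI subsetI)
    fix t assume t: "t \<in> S \<inter> reflect (flip_ends S)"
    then have "t \<in> cells p L a b" using S by simp
    then obtain i r where ir: "0 \<le> i" "i < p" "a \<le> r" "r < b" "t = of_int i * L + r"
      unfolding cells_iff by blast
    have "1 - t \<in> flip_ends S" using t unfolding reflect_def by auto
    then obtain j where j: "0 \<le> j" "j < p" "of_int j * L + a < 1 - t" "1 - t \<le> of_int j * L + b"
      unfolding flip by auto
    define s where "s = 1 - t - of_int j * L"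
    have s: "a < s" "s \<le> b" using j by (auto simp: s_def)
    \<comment> \<open>The right-hand side is smaller than \<open>L\<close> in absolute value, so the
      multiple of \<open>L\<close> on the left vanishes; the cell indices are then
      complementary.\<close>
    have eq: "of_int (p - 1 - i - j) * L = r + s - (L - \<beta>)" using ir \<beta> by (simp add: s_def algebra_simps)
    have "r + s - (L - \<beta>) < L" "- L < r + s - (L - \<beta>)" using ir s ab \<beta> by linarith+
    then have "of_int (p - 1 - i - j) * L < of_int 1 * L" "of_int (- 1) * L < of_int (p - 1 - i - j) * L"
      unfolding eq by simp_all
    then have "p - 1 - i - j = 0" using L by (simp only: mult_less_cancel_right_pos of_int_less_iff)
    then have "s = L - \<beta> - r" using eq by simp
    then show "t \<in> ?D" unfolding cells_iff using ir s by (intro exI[of _ i] exI[of _ r]) auto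
  next
    fix t assume t: "t \<in> ?D"
    then have "t \<in> S" unfolding S cells_iff by auto
    moreover obtain i r where "0 \<le> i" "i < p" "a < r" "r \<le> b" "1 - t = of_int i * L + r"
      using D_flip[OF t] by blast
    then have "1 - t \<in> flip_ends S" unfolding flip by (intro UN_I[of i]) auto
    then have "t \<in> reflect (flip_ends S)" unfolding reflect_def by (rule image_eqI[rotated]) simp
    ultimately show "t \<in> S \<inter> reflect (flip_ends S)" by blast
  qed
  have D_S: "t \<in> S" if "t \<in> ?D" for t using that D by blast
  have D01: "0 \<le> t \<and> t < 1 \<and> (t < x1 \<or> x2 \<le> t)" if "t \<in> ?D" for t
    using D_S[OF that] M_S(2) by force
  have "M ` ?D = ?D"
  proof (rule cells_rotation[OF L p, where k = k])
    fix t assume t: "t \<in> ?D"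
    show "0 \<le> M t \<and> M t < of_int p * L \<and>
        (\<exists>n::int. M t = t + of_int k * L + of_int n * (of_int p * L))"
      using D01[OF t] M_range[of t] rot[OF D_S[OF t]] \<beta> by auto
  qed (use ab \<beta> in auto)
  moreover have "N ` ?D = ?D"
  proof (rule cells_rotation[OF L p, where k = "- k"])
    fix t assume t: "t \<in> ?D"
    obtain i r where ir: "0 \<le> i" "i < p" "a < r" "r \<le> b" "1 - t = of_int i * L + r"
      using D_flip[OF t] by blast
    have "0 < 1 - t" "1 - t \<le> 1" using D01[OF t] by auto
    from coherent_left_limit[OF this] obtain \<delta> where \<delta>: "0 < \<delta>"
      "\<And>s. 1 - t - \<delta> < s \<Longrightarrow> s < 1 - t \<Longrightarrow> coherent_transf \<alpha> x1 x2 (1 - t) = M s + (1 - t - s)" by blast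
    \<comment> \<open>The point \<open>1 - t\<close> may be the right end of its interval and so lie
      outside \<open>S\<close>; a point \<open>s\<close> of the same interval just to its left is in
      \<open>S\<close> and is rotated by \<open>M\<close>.\<close>
    have "max (1 - t - \<delta>) (of_int i * L + a) < 1 - t" using \<delta>(1) ir by simp
    then obtain s where s: "max (1 - t - \<delta>) (of_int i * L + a) < s" "s < 1 - t" using dense by blast
    then have "s \<in> S" unfolding S cells_iff using ir
      by (intro exI[of _ i] exI[of _ "s - of_int i * L"]) auto
    from rot[OF this] obtain n :: int where "M s = s + of_int k * L + of_int n * (of_int p * L)" ..
    then have "N t = t + of_int (- k) * L + of_int (- n) * (of_int p * L)"
      unfolding N_def using \<delta>(2)[of s] s by simp
    then show "0 \<le> N t \<and> N t < of_int p * L \<and>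
        (\<exists>n::int. N t = t + of_int (- k) * L + of_int n * (of_int p * L))"
      using D01[OF t] N_range[of t] \<beta> by (intro conjI exI[of _ "- n"]) auto
  qed (use ab \<beta> in auto)
  moreover have "?D \<subseteq> {0..<1} - ({x1..<x2} \<union> {1 - x2..<1 - x1})"
  proof
    fix t assume t: "t \<in> ?D"
    have "\<not> (1 - x2 \<le> t \<and> t < 1 - x1)"
    proof
      assume H: "1 - x2 \<le> t \<and> t < 1 - x1"
      obtain i r where ir: "0 \<le> i" "i < p" "a < r" "r \<le> b" "1 - t = of_int i * L + r"
        using D_flip[OF t] by blast
      \<comment> \<open>If \<open>1 - t\<close> were in the mirrored hole, points of
        \<open>S\<close> just to its left would be in the hole itself.\<close>
      have "max x1 (of_int i * L + a) < 1 - t" using H ir by simp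
      then obtain s where s: "max x1 (of_int i * L + a) < s" "s < 1 - t" using dense by blast
      then have "s \<in> S" unfolding S cells_iff using ir
        by (intro exI[of _ i] exI[of _ "s - of_int i * L"]) auto
      then show False using M_S(2) s H by force
    qed
    then show "t \<in> {0..<1} - ({x1..<x2} \<union> {1 - x2..<1 - x1})" using D01[OF t] by auto
  qed
  ultimately have "?D \<subseteq> E"
    by (intro sym_max_invariant_set_greatest(2)) (simp only: sym_invariant_iff simp_thms)
  then show ?thesis using E D by blast
qed

section \<open>Periodicity of the symmetric set\<close>

text \<open>\<open>rotation_lattice\<close> is applied on the circle of length
  \<open>1 + \<beta>\<close>. Translation by multiples of \<open>L\<close> shows that an offset
  occurring in \<open>E\<close> occurs in every cell; the copy in the last cell must lie below 1,
  which bounds the offset by \<open>L - \<beta>\<close>.\<close>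

lemma E_periodic:
  assumes "E \<noteq> {}" "0 \<le> \<beta>"
    and rot: "\<And>e. e \<in> E \<Longrightarrow> \<exists>j::int. M e = e + c + of_int j * (1 + \<beta>)"
    and avoid: "\<And>e (j::int). e \<in> E \<Longrightarrow> e + of_int j * (1 + \<beta>) \<notin> {y..<y + h}"
  obtains L and k p m n :: int where "h < L" "0 < p" "c = of_int k * L" "1 = of_int p * L - \<beta>"
    "k * m + p * n = 1"
    "\<And>e. e \<in> E \<Longrightarrow> \<exists>i r. 0 \<le> i \<and> i < p \<and> 0 \<le> r \<and> r < L - \<beta> \<and> e = of_int i * L + r \<and>
      (\<forall>q. 0 \<le> q \<and> q < p \<longrightarrow> of_int q * L + r \<in> E)"
proof -
  have "0 < 1 + \<beta>" "0 < h" using assms(2) hole by auto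
  from rotation_lattice[OF assms(1) M_E this rot avoid]
  obtain L and k p m n :: int where *: "h < L" "0 < p" "c = of_int k * L" "1 + \<beta> = of_int p * L"
    "k * m + p * n = 1"
    "\<And>e (i::int). e \<in> E \<Longrightarrow> \<exists>e'\<in>E. \<exists>j::int. e' = e + of_int i * L + of_int j * (1 + \<beta>)"
    by metis
  have L: "0 < L" using *(1) \<open>0 < h\<close> by linarith
  show ?thesis
  proof (rule that[OF *(1-3) _ *(5)])
    show "1 = of_int p * L - \<beta>" using *(4) by simp
    fix e assume e: "e \<in> E"
    obtain i :: int and r where ir: "e = of_int i * L + r" "0 \<le> r" "r < L" by (rule cell_exists[OF L])
    have i: "0 \<le> i" "i < p"
      using cell_index_range[OF L ir(2,3), of i p] E_props(1,2)[OF e] ir *(4) assms(2) by auto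
    have all: "of_int q * L + r \<in> E" if q: "0 \<le> q" "q < p" for q
    proof -
      obtain e' and j :: int where e': "e' \<in> E" "e' = e + of_int (q - i) * L + of_int j * (1 + \<beta>)"
        using *(6)[OF e] by blast
      then have eq: "e' = of_int (q + j * p) * L + r" unfolding *(4) ir(1) by (simp add: algebra_simps)
      then have "0 \<le> q + j * p" "q + j * p < p"
        using cell_index_range[OF L ir(2,3), of "q + j * p" p] E_props(1,2)[OF e'(1)] *(4) assms(2) by auto
      then have "q + j * p = q" using q by (metis mod_mult_self1 mod_pos_pos_trivial)
      then show ?thesis using e'(1) unfolding eq by (simp only:)
    qed
    then have "of_int (p - 1) * L + r < 1" using E_props(2)[OF all[of "p - 1"]] *(2) by simp
    then have "r < L - \<beta>" using *(4) by (simp add: algebra_simps)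
    then show "\<exists>i r. 0 \<le> i \<and> i < p \<and> 0 \<le> r \<and> r < L - \<beta> \<and> e = of_int i * L + r \<and>
      (\<forall>q. 0 \<le> q \<and> q < p \<longrightarrow> of_int q * L + r \<in> E)"
      using i ir all by blast
  qed
qed

text \<open>A translate by a nonzero integer leaves the unit interval. The factor
  \<open>1 + 0\<close> is the circle length \<open>1 + \<beta>\<close> at \<beta> = 0.\<close>

lemma avoid_hole:
  assumes "e \<in> E" shows "e + of_int (j::int) * (1 + 0) \<notin> {x1..<x1 + h}"
proof
  assume a: "e + of_int j * (1 + 0) \<in> {x1..<x1 + h}"
  then have "of_int j < (1::real)" "(-1::real) < of_int j" using E_props(1,2)[OF assms] hole by auto
  then have "j = 0" by linarith
  then show False using a E_props(3)[OF assms] by auto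
qed

section \<open>The three positions of the symmetric set relative to the hole\<close>

text \<open>On \<open>E\<close> the map is a rotation by \<open>\<alpha> + h\<close> of the circle
  of length 1. All copies of an offset precede the hole, even the one in the last cell, so the hole
  lies in cell \<open>p - 1\<close>.\<close>

lemma E_eq_left:
  assumes ne: "E \<noteq> {}" and left: "\<And>e. e \<in> E \<Longrightarrow> e < x1"
  shows "E = S \<inter> reflect (flip_ends S)"
proof -
  have "\<exists>j::int. M e = e + (\<alpha> + h) + of_int j * (1 + 0)" if "e \<in> E" for e
    using M_left[OF E_props(1)[OF that] left[OF that]]
    by (intro exI[of _ "- \<lfloor>e + \<alpha> + h\<rfloor>"]) (simp add: frac_def)
  from E_periodic[OF ne order_refl this avoid_hole]
  obtain L and k p m n :: int where P: "h < L" "0 < p" "\<alpha> + h = of_int k * L" "1 = of_int p * L - 0"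
    "k * m + p * n = 1"
    and PE: "\<And>e. e \<in> E \<Longrightarrow> \<exists>i r. 0 \<le> i \<and> i < p \<and> 0 \<le> r \<and> r < L - 0 \<and> e = of_int i * L + r \<and>
      (\<forall>q. 0 \<le> q \<and> q < p \<longrightarrow> of_int q * L + r \<in> E)" by metis
  have L: "0 < L" using P(1) hole by linarith
  define \<xi> where "\<xi> = x1 - of_int (p - 1) * L"
  have \<xi>: "\<xi> = x1 - 1 + L" unfolding \<xi>_def using P(4) by (simp add: algebra_simps)
  have E: "\<exists>i r. 0 \<le> i \<and> i < p \<and> 0 \<le> r \<and> r < L \<and> r < \<xi> \<and> L - \<xi> \<le> r \<and> e = of_int i * L + r"
    if "e \<in> E" for e
  proof -
    obtain i r where ir: "0 \<le> i" "i < p" "0 \<le> r" "r < L" "e = of_int i * L + r"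
      "\<And>q. 0 \<le> q \<and> q < p \<Longrightarrow> of_int q * L + r \<in> E" using PE[OF \<open>e \<in> E\<close>] by auto
    have "of_int (p - 1) * L + r < x1" using left[OF ir(6)[of "p - 1"]] P(2) by simp
    \<comment> \<open>The copy in the first cell is an image of a left point and hence lies beyond
      the reflected hole; this gives the mirrored bound \<open>L - \<xi>\<close>.\<close>
    moreover have "r \<in> E" using ir(6)[of 0] P(2) by simp
    then have "r \<in> M ` E" using M_E by simp
    then have "1 - x1 \<le> r" using left M_E_left by auto
    ultimately show ?thesis using ir \<xi> unfolding \<xi>_def by (intro exI[of _ i] exI[of _ r]) simp
  qed
  have pos: "0 < \<xi>" using ne E by fastforce
  have x1: "x1 = of_int (p - 1) * L + \<xi>" unfolding \<xi>_def by simp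
  have good: "\<exists>n::int. M t = t + of_int k * L + of_int n * (of_int p * L)"
    if t: "0 \<le> t \<and> t < x1 \<or> of_int (p - 1 + 1) * L \<le> t \<and> t < 1" for t
    using t M_left[of t] P by (intro exI[of _ "- \<lfloor>t + \<alpha> + h\<rfloor>"]) (auto simp: frac_def)
  have drop: "\<exists>n::int. M t = t + of_int k * L - h + of_int n * (of_int p * L)"
    if t: "x2 \<le> t" "t < of_int (p - 1 + 1) * L" "t < 1" for t
    using t M_right[of t] P by (intro exI[of _ "- \<lfloor>t + \<alpha>\<rfloor>"]) (auto simp: frac_def)
  have "\<xi> + h \<le> L" "\<xi> \<le> L - 0" using \<xi> hole by auto
  note S = S_eq_cells_above_gap[OF L P(2,5) order_refl P(4) pos this _ _ x1 good drop]
  show ?thesis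
  proof (rule E_eq_if_S_eq_cells[OF L P(2) order_refl P(4) order_refl pos \<open>\<xi> \<le> L - 0\<close>, where k = k])
    show "E \<subseteq> cells p L (max 0 (L - 0 - \<xi>)) (min \<xi> (L - 0 - 0))"
      unfolding cells_iff subset_iff using E by fastforce
  qed (use S P(2) in auto)
qed

text \<open>Now \<open>E\<close> rotates by \<alpha> on the circle of length 1. Already the first
  copy of an offset lies beyond the hole, so the hole is in cell 0 and \<open>x2\<close> is the
  threshold.\<close>

lemma E_eq_right:
  assumes ne: "E \<noteq> {}" and right: "\<And>e. e \<in> E \<Longrightarrow> x2 \<le> e"
  shows "E = S \<inter> reflect (flip_ends S)"
proof -
  have "\<exists>j::int. M e = e + \<alpha> + of_int j * (1 + 0)" if "e \<in> E" for e
    using M_right[OF right[OF that] E_props(2)[OF that]]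
    by (intro exI[of _ "- \<lfloor>e + \<alpha>\<rfloor>"]) (simp add: frac_def)
  from E_periodic[OF ne order_refl this avoid_hole]
  obtain L and k p m n :: int where P: "h < L" "0 < p" "\<alpha> = of_int k * L" "1 = of_int p * L - 0"
    "k * m + p * n = 1"
    and PE: "\<And>e. e \<in> E \<Longrightarrow> \<exists>i r. 0 \<le> i \<and> i < p \<and> 0 \<le> r \<and> r < L - 0 \<and> e = of_int i * L + r \<and>
      (\<forall>q. 0 \<le> q \<and> q < p \<longrightarrow> of_int q * L + r \<in> E)" by metis
  have L: "0 < L" using P(1) hole by linarith
  have E: "\<exists>i r. 0 \<le> i \<and> i < p \<and> r < L \<and> x2 \<le> r \<and> r < L - x2 \<and> e = of_int i * L + r"
    if "e \<in> E" for e
  proof -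
    obtain i r where ir: "0 \<le> i" "i < p" "0 \<le> r" "r < L" "e = of_int i * L + r"
      "\<And>q. 0 \<le> q \<and> q < p \<Longrightarrow> of_int q * L + r \<in> E" using PE[OF \<open>e \<in> E\<close>] by auto
    have "x2 \<le> r" using ir(6)[of 0] right[of r] P(2) by simp
    \<comment> \<open>The copy in the last cell is an image of a right point and so lies before the
      reflected hole.\<close>
    moreover have "of_int (p - 1) * L + r \<in> E" using ir(6)[of "p - 1"] P(2) by simp
    then have "of_int (p - 1) * L + r \<in> M ` E" using M_E by simp
    then have "of_int (p - 1) * L + r < 1 - x2" using right M_E_right by auto
    then have "r < L - x2" using P(4) by (simp add: algebra_simps)
    ultimately show ?thesis using ir by (intro exI[of _ i] exI[of _ r]) simp
  qed
  have x2: "x2 < L" using ne E by fastforce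
  have x2': "x2 = of_int 0 * L - 0 + x2" by simp
  have good: "\<exists>n::int. M t = t + of_int k * L + of_int n * (of_int p * L)"
    if t: "0 \<le> t \<and> t < of_int 0 * L - 0 \<or> x2 \<le> t \<and> t < 1" for t
    using t M_right[of t] P by (intro exI[of _ "- \<lfloor>t + \<alpha>\<rfloor>"]) (auto simp: frac_def)
  have rise: "\<exists>n::int. M t = t + of_int k * L + h + of_int n * (of_int p * L)"
    if t: "of_int 0 * L - 0 \<le> t" "0 \<le> t" "t < x1" for t
    using t M_left[of t] P by (intro exI[of _ "- \<lfloor>t + \<alpha> + h\<rfloor>"]) (auto simp: frac_def)
  have "0 \<le> x2" "h \<le> x2" using hole by auto
  note S = S_eq_cells_below_gap[OF L P(2,5) order_refl \<open>0 \<le> x2\<close> P(4) \<open>h \<le> x2\<close> x2 order_refl P(2) x2' good rise]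
  show ?thesis
  proof (rule E_eq_if_S_eq_cells[OF L P(2) order_refl P(4), where k = k and a = x2 and b = L])
    show "E \<subseteq> cells p L (max x2 (L - 0 - L)) (min L (L - 0 - x2))"
      unfolding cells_iff subset_iff using E \<open>0 \<le> x2\<close> by fastforce
  qed (use S \<open>0 \<le> x2\<close> x2 in auto)
qed

text \<open>Inserting an extra arc of length \<open>h\<close> after the unit interval turns both
  branches of \<open>M\<close> on \<open>E\<close> into one rotation by
  \<open>\<alpha> + h\<close>.\<close>

lemma E_eq_both:
  assumes u: "u \<in> E" "u < x1" and v: "v \<in> E" "x2 \<le> v"
  shows "E = S \<inter> reflect (flip_ends S)"
proof -
  have both: "M u = u + \<alpha> + h \<and> M v = v + \<alpha> - 1"
    if u: "u \<in> E" "u < x1" and v: "v \<in> E" "x2 \<le> v" for u v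
  proof -
    note Eu = E_props[OF u(1)] and Ev = E_props[OF v(1)]
    let ?i = "\<lfloor>u + \<alpha> + h\<rfloor>" and ?j = "\<lfloor>v + \<alpha>\<rfloor>"
    have Mu: "M u = u + \<alpha> + h - of_int ?i" using M_left Eu u by (simp add: frac_def)
    have Mv: "M v = v + \<alpha> - of_int ?j" using M_right Ev v by (simp add: frac_def)
    \<comment> \<open>\<open>M u\<close> lies beyond the reflected hole and \<open>M v\<close>
      before it, although \<open>u + h < v\<close>; so \<open>v\<close> wraps around more often than
      \<open>u\<close>, and the bounds 0 and 1 fix both winding numbers.\<close>
    have "of_int ?i < (of_int ?j :: real)"
      using M_E_left[OF u] M_E_right[OF v] u(2) v(2) hole unfolding Mu Mv by linarith
    then have "?i < ?j" by (simp only: of_int_less_iff)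
    moreover have "0 \<le> ?i" using Eu alpha hole by simp
    moreover have "?j \<le> 1" using Ev alpha by linarith
    ultimately have "?i = 0" "?j = 1" by linarith+
    then show ?thesis using Mu Mv by simp
  qed
  have M_low: "M e = e + \<alpha> + h" if "e \<in> E" "e < x1" for e using both[OF that v] by blast
  have M_high: "M e = e + \<alpha> - 1" if "e \<in> E" "x2 \<le> e" for e using both[OF u that] by blast
  \<comment> \<open>On the right side \<open>\<alpha> - 1\<close> equals \<open>\<alpha> + h\<close>
    minus one full turn \<open>1 + h\<close>.\<close>
  have rot: "\<exists>j::int. M e = e + (\<alpha> + h) + of_int j * (1 + h)" if e: "e \<in> E" for e
  proof (cases "e < x1")
    case True
    then show ?thesis using M_low[OF e] by (intro exI[of _ 0]) simp
  next
    case False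
    then show ?thesis using M_high[OF e] E_props(3)[OF e] by (intro exI[of _ "- 1"]) simp
  qed
  \<comment> \<open>The avoided interval is the arc added to the unit interval.\<close>
  have avoid: "e + of_int j * (1 + h) \<notin> {1..<1 + h}" if e: "e \<in> E" for e and j :: int
  proof -
    consider "j = 0" | "of_int 1 \<le> (of_int j :: real)" | "of_int j \<le> (of_int (- 1) :: real)"
      unfolding of_int_le_iff by linarith
    then show ?thesis
    proof cases
      case 2
      then have "1 * (1 + h) \<le> of_int j * (1 + h)" using hole by (intro mult_right_mono) auto
      then show ?thesis using E_props[OF e] by simp
    next
      case 3
      then have "of_int j * (1 + h) \<le> of_int (- 1) * (1 + h)" using hole by (intro mult_right_mono) auto
      then show ?thesis using E_props[OF e] hole by simp
    qed (use E_props[OF e] in simp)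
  qed
  have ne: "E \<noteq> {}" and h0: "0 \<le> h" using u hole by auto
  from E_periodic[OF ne h0 rot avoid]
  obtain L and k p m n :: int where P: "h < L" "0 < p" "\<alpha> + h = of_int k * L" "1 = of_int p * L - h"
    "k * m + p * n = 1"
    and PE: "\<And>e. e \<in> E \<Longrightarrow> \<exists>i r. 0 \<le> i \<and> i < p \<and> 0 \<le> r \<and> r < L - h \<and> e = of_int i * L + r \<and>
      (\<forall>q. 0 \<le> q \<and> q < p \<longrightarrow> of_int q * L + r \<in> E)" by metis
  have L: "0 < L" using P(1) hole by linarith
  have "0 < of_int k * L" using P(3) alpha hole by simp
  then have k: "0 < k" using L by (simp add: zero_less_mult_iff)
  have alpha': "1 - \<alpha> = of_int (p - k) * L" using P(3,4) by (simp add: algebra_simps)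
  then have "0 < of_int (p - k) * L" using alpha by simp
  then have kp: "k < p" using L by (simp add: zero_less_mult_iff)
  \<comment> \<open>For points of \<open>E\<close>, the cells up to index \<open>p - k - 1\<close>
    are those that a shift by \<open>k\<close> moves without wrapping, so the hole separates the
    copies in the cells \<open>p - k - 1\<close> and \<open>p - k\<close>.\<close>
  define \<xi> where "\<xi> = x1 - of_int (p - k - 1) * L"
  have x1: "x1 = of_int (p - k - 1) * L + \<xi>" unfolding \<xi>_def by simp
  have E: "\<exists>i r. 0 \<le> i \<and> i < p \<and> 0 \<le> r \<and> r < L - h \<and> r < \<xi> \<and> \<xi> - (L - h) \<le> r \<and>
      L - h - \<xi> \<le> r \<and> r < L - h - \<xi> + (L - h) \<and> e = of_int i * L + r"
    if "e \<in> E" for e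
  proof -
    obtain i r where ir: "0 \<le> i" "i < p" "0 \<le> r" "r < L - h" "e = of_int i * L + r"
      "\<And>q. 0 \<le> q \<and> q < p \<Longrightarrow> of_int q * L + r \<in> E" using PE[OF \<open>e \<in> E\<close>] by auto
    have r: "0 \<le> r" "r < L" using ir hole by auto
    have left: "q + k < p \<and> M (of_int q * L + r) = of_int (q + k) * L + r"
      if q: "0 \<le> q" "q < p" "of_int q * L + r < x1" for q
    proof -
      have qE: "of_int q * L + r \<in> E" using ir(6) q by blast
      have "M (of_int q * L + r) = of_int (q + k) * L + r"
        using M_low[OF qE q(3)] P(3) by (simp add: algebra_simps)
      moreover from this have "q + k < p"
        using cell_index_range(2)[OF L r, of "q + k" p] E_props(1,2)[OF E_props(5)[OF qE]] P(4) h0 by simp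
      ultimately show ?thesis by blast
    qed
    have right: "0 \<le> q + k - p \<and> M (of_int q * L + r) = of_int (q + k - p) * L + r"
      if q: "0 \<le> q" "q < p" "x2 \<le> of_int q * L + r" for q
    proof -
      have qE: "of_int q * L + r \<in> E" using ir(6) q by blast
      have "M (of_int q * L + r) = of_int (q + k - p) * L + r"
        using M_high[OF qE q(3)] alpha' by (simp add: algebra_simps)
      moreover from this have "0 \<le> q + k - p"
        using cell_index_range(1)[OF L r, of "q + k - p" p] E_props(1,2)[OF E_props(5)[OF qE]] P(4) h0 by simp
      ultimately show ?thesis by blast
    qed
    have split: "of_int q * L + r < x1 \<or> x2 \<le> of_int q * L + r" if "0 \<le> q" "q < p" for q
      using E_props(3) ir(6) that by blast
    have lt: "of_int q * L + r < x1" if "0 \<le> q" "q < p - k" for q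
      using split[of q] right[of q] that k by force
    have ge: "x2 \<le> of_int q * L + r" if "p - k \<le> q" "q < p" for q
      using split[of q] left[of q] that kp by force
    \<comment> \<open>The four bounds place the hole between the copies of \<open>r\<close> in cells
      \<open>p - k - 1\<close> and \<open>p - k\<close>, and the reflected hole between those in
      cells \<open>k - 1\<close> and \<open>k\<close>.\<close>
    have 1: "of_int (p - k - 1) * L + r < x1" using lt[of "p - k - 1"] kp by simp
    have 2: "x2 \<le> of_int (p - k) * L + r" using ge[of "p - k"] k by simp
    have 3: "1 - x1 \<le> of_int k * L + r"
      using M_E_left[OF ir(6)[of 0]] left[of 0] lt[of 0] kp P(2) by simp
    have 4: "of_int (k - 1) * L + r < 1 - x2"
      using M_E_right[OF ir(6)[of "p - 1"]] right[of "p - 1"] ge[of "p - 1"] k P(2) by simp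
    show ?thesis
    proof (intro exI[of _ i] exI[of _ r] conjI ir(1-5))
      show "r < \<xi>" using 1 x1 by simp
      show "\<xi> - (L - h) \<le> r" using 2 x1 by (simp add: algebra_simps)
      show "L - h - \<xi> \<le> r" using 3 x1 P(4) by (simp add: algebra_simps)
      show "r < L - h - \<xi> + (L - h)" using 4 x1 P(4) by (simp add: algebra_simps)
    qed
  qed
  obtain r where r: "0 \<le> r" "r < L - h" "r < \<xi>" "\<xi> - (L - h) \<le> r" "L - h - \<xi> \<le> r" "r < L - h - \<xi> + (L - h)"
    using E[OF u(1)] by blast
  have MU: "M t = frac (t + of_int k * L)" if "0 \<le> t" "t < x1" for t
    using M_left[OF that] P(3) by (simp add: add.assoc)
  have MV: "M t = frac (t + of_int k * L - h)" if "x2 \<le> t" "t < 1" for t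
    using M_right[OF that] P(3)[symmetric] by simp
  have kL: "0 \<le> of_int k * L" "of_int k * L - h < 1" using P(3)[symmetric] alpha hole by auto
  \<comment> \<open>From cell \<open>p - k\<close> on, the shift by \<open>of_int k * L - h\<close>
    passes 1; the loss of \<open>h\<close> and the integer 1 add up to one full turn
    \<open>of_int p * L\<close>.\<close>
  have MV_wrap: "M t = t + of_int k * L + of_int (- 1) * (of_int p * L)"
    if t: "x2 \<le> t" "t < 1" "of_int (p - k) * L \<le> t" for t
  proof -
    have "of_int p * L \<le> t + of_int k * L" using t(3) by (simp add: algebra_simps)
    then show ?thesis
      using MV[OF t(1,2)] frac_eqI[of "t + of_int k * L - h" 1] t P(4) kL by simp
  qed
  show ?thesis
  \<comment> \<open>The hole either fits into cell \<open>p - k - 1\<close> or reaches past its end.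
    In the second case it fits into cell \<open>p - k\<close> when cells are measured from
    \<open>-h\<close>.\<close>
  proof (cases "\<xi> \<le> L - h")
    case True
    have jL: "of_int (p - k - 1 + 1) * L = of_int (p - k) * L" by simp
    have x1': "x1 \<le> 1 - of_int k * L" using x1 True P(4) by (simp add: algebra_simps)
    have good: "\<exists>n::int. M t = t + of_int k * L + of_int n * (of_int p * L)"
      if t: "0 \<le> t \<and> t < x1 \<or> of_int (p - k - 1 + 1) * L \<le> t \<and> t < 1" for t
      using t
    proof
      assume t: "0 \<le> t \<and> t < x1"
      then have "M t = t + of_int k * L"
        using MU frac_eqI[of "t + of_int k * L" 0] x1' kL by simp
      then show ?thesis by (intro exI[of _ 0]) simp
    next
      assume t: "of_int (p - k - 1 + 1) * L \<le> t \<and> t < 1"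
      have "x2 \<le> of_int (p - k) * L" using x1 True by (simp add: algebra_simps)
      then show ?thesis using MV_wrap[of t] t unfolding jL by (intro exI[of _ "- 1"]) simp
    qed
    have drop: "\<exists>n::int. M t = t + of_int k * L - h + of_int n * (of_int p * L)"
      if t: "x2 \<le> t" "t < of_int (p - k - 1 + 1) * L" "t < 1" for t
    proof -
      have "t + of_int k * L - h < 1" using t(2) P(4) by (simp add: algebra_simps)
      moreover have "0 \<le> t + of_int k * L - h" using t(1) hole kL by linarith
      ultimately have "M t = t + of_int k * L - h"
        using MV[OF t(1,3)] frac_eqI[of "t + of_int k * L - h" 0] by simp
      then show ?thesis by (intro exI[of _ 0]) simp
    qed
    have c: "0 < \<xi>" "\<xi> + h \<le> L" "0 \<le> p - k - 1" "p - k - 1 < p" using r True kp k by auto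
    note S = S_eq_cells_above_gap[OF L P(2,5) h0 P(4) c(1,2) True c(3,4) x1 good drop]
    show ?thesis
    proof (rule E_eq_if_S_eq_cells[OF L P(2) h0 P(4) order_refl c(1) True S])
      show "E \<subseteq> cells p L (max 0 (L - h - \<xi>)) (min \<xi> (L - h - 0))"
        unfolding cells_iff subset_iff using E by fastforce
    qed
  next
    case False
    \<comment> \<open>This is the offset of \<open>x2\<close> in the displaced cell, whose lower end
      is \<open>of_int (p - k) * L - h\<close>.\<close>
    define \<omega> where "\<omega> = \<xi> - (L - h) + h"
    have x2: "x2 = of_int (p - k) * L - h + \<omega>" using x1 by (simp add: \<omega>_def algebra_simps)
    have good: "\<exists>n::int. M t = t + of_int k * L + of_int n * (of_int p * L)"
      if t: "0 \<le> t \<and> t < of_int (p - k) * L - h \<or> x2 \<le> t \<and> t < 1" for t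
      using t
    proof
      assume t: "0 \<le> t \<and> t < of_int (p - k) * L - h"
      then have "t < x1" "t + of_int k * L < 1" using x2 False P(4) by (auto simp: \<omega>_def algebra_simps)
      then have "M t = t + of_int k * L"
        using t MU frac_eqI[of "t + of_int k * L" 0] kL by simp
      then show ?thesis by (intro exI[of _ 0]) simp
    next
      assume t: "x2 \<le> t \<and> t < 1"
      then have "of_int (p - k) * L \<le> t" using x2 False by (simp add: \<omega>_def)
      then show ?thesis using MV_wrap[of t] t by (intro exI[of _ "- 1"]) simp
    qed
    have rise: "\<exists>n::int. M t = t + of_int k * L + h + of_int n * (of_int p * L)"
      if t: "of_int (p - k) * L - h \<le> t" "0 \<le> t" "t < x1" for t
    proof -
      have "1 \<le> t + of_int k * L" using t(1) P(4) by (simp add: algebra_simps)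
      moreover have "t + of_int k * L < 2" using t(3) hole kL by linarith
      ultimately have "M t = t + of_int k * L + h + of_int (- 1) * (of_int p * L)"
        using MU[OF t(2,3)] frac_eqI[of "t + of_int k * L" 1] P(4) by simp
      then show ?thesis ..
    qed
    have c: "h \<le> \<omega>" "\<omega> < L" "0 \<le> p - k" "p - k < p" using r False kp k by (auto simp: \<omega>_def)
    note S = S_eq_cells_below_gap[OF L P(2,5) h0 c(1) P(4) c(1,2,3,4) x2 good rise]
    show ?thesis
    proof (rule E_eq_if_S_eq_cells[OF L P(2) h0 P(4) _ _ order_refl S])
      show "0 \<le> \<omega> - h" "\<omega> - h < L - h" using c by auto
      show "E \<subseteq> cells p L (max (\<omega> - h) (L - h - (L - h))) (min (L - h) (L - h - (\<omega> - h)))"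
        unfolding cells_iff subset_iff \<omega>_def using E by fastforce
    qed
  qed
qed

lemma E_eq:
  assumes "E \<noteq> {}"
  shows "E = S \<inter> reflect (flip_ends S)"
  using E_eq_left[OF assms] E_eq_right[OF assms] E_eq_both E_props(3) by blast

end

theorem corollary1p6:
  fixes \<alpha> x1 x2 :: real
  assumes "0 \<le> \<alpha>" and "\<alpha> < 1"
    and "0 \<le> x1" and "x1 < x2" and "x2 \<le> 1"
    and "sym_max_invariant_set \<alpha> x1 x2 \<noteq> {}"
  shows "sym_max_invariant_set \<alpha> x1 x2 =
           max_invariant_set \<alpha> x1 x2 \<inter> reflect (flip_ends (max_invariant_set \<alpha> x1 x2))
       \<and> (\<forall>t\<in>sym_max_invariant_set \<alpha> x1 x2.
            transf \<alpha> x1 x2 (1 - coherent_transf \<alpha> x1 x2 (1 - t)) = t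
            \<and> 1 - coherent_transf \<alpha> x1 x2 (1 - transf \<alpha> x1 x2 t) = t)"
proof -
  interpret hole_map \<alpha> x1 x2 using assms(1-5) by unfold_locales
  show ?thesis using E_eq[OF assms(6)] M_N_E N_M_E unfolding N_def by blast
qed

end
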